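(* Let $r>0$. There exists $\delta=\delta(r)>0$ such that for every $\mathbf{n}\in\mathcal{M}$ with $0<\|\mathbf{n}-\mathbf{e}_3\|_{L^2(\mathbb{R}^2)}\le\delta$ one has $E_r[\mathbf{n}]>E_r[\mathbf{e}_3]$ (where $E_r[\mathbf{e}_3]=0$).
   Context: Maps $\mathbf{n}=(n_1,n_2,n_3):\mathbb{R}^2\to\mathbb{S}^2\subset\mathbb{R}^3$ (with weak derivatives in $L^2_{loc}$); $\mathbf{e}_1,\mathbf{e}_2,\mathbf{e}_3$ is the canonical basis of $\mathbb{R}^3$. Define $D[\mathbf{n}]=\frac12\int_{\mathbb{R}^2}|\nabla\mathbf{n}|^2dx$, $H[\mathbf{n}]=\int_{\mathbb{R}^2}(\mathbf{n}-\mathbf{e}_3)\cdot(\nabla\times\mathbf{n})dx$ where $\nabla\times\mathbf{n}=(\partial_2 n_3,-\partial_1 n_3,\partial_1 n_2-\partial_2 n_1)$, $V[\mathbf{n}]=\frac18\int_{\mathbb{R}^2}|\mathbf{n}-\mathbf{e}_3|^4dx$, and $E_r=D+rH+V$ for $r>0$. The energy space is $\mathcal{M}=\{\mathbf{n}:\mathbb{R}^2\to\mathbb{S}^2\mid D[\mathbf{n}]+V[\mathbf{n}]<\infty\}$. *)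

theory Defs
  imports "HOL-Analysis.Analysis"
begin

definition e3 :: "real^3" where "e3 = axis 3 1"

fun dpart :: "2 list \<Rightarrow> (real^2 \<Rightarrow> real) \<Rightarrow> (real^2 \<Rightarrow> real)" where
  "dpart [] f = f"
| "dpart (i # is) f = (\<lambda>x. frechet_derivative (dpart is f) (at x) (axis i 1))"

definition smooth_fn :: "(real^2 \<Rightarrow> real) \<Rightarrow> bool" where
  "smooth_fn f \<longleftrightarrow> (\<forall>is. dpart is f differentiable_on UNIV)"

definition test_fun :: "(real^2 \<Rightarrow> real) \<Rightarrow> bool" where
  "test_fun \<phi> \<longleftrightarrow> smooth_fn \<phi> \<and> compact (closure {x. \<phi> x \<noteq> 0})"

definition loc_L1 :: "(real^2 \<Rightarrow> real) \<Rightarrow> bool" where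
  "loc_L1 g \<longleftrightarrow> g \<in> borel_measurable lborel \<and>
     (\<forall>K. compact K \<longrightarrow> (\<integral>\<^sup>+ x \<in> K. ennreal \<bar>g x\<bar> \<partial>lborel) < \<infinity>)"

definition loc_L2 :: "(real^2 \<Rightarrow> real) \<Rightarrow> bool" where
  "loc_L2 g \<longleftrightarrow> g \<in> borel_measurable lborel \<and>
     (\<forall>K. compact K \<longrightarrow> (\<integral>\<^sup>+ x \<in> K. ennreal ((g x)\<^sup>2) \<partial>lborel) < \<infinity>)"

definition weak_partial :: "2 \<Rightarrow> (real^2 \<Rightarrow> real) \<Rightarrow> (real^2 \<Rightarrow> real) \<Rightarrow> bool" where
  "weak_partial i f g \<longleftrightarrow> loc_L1 f \<and> loc_L1 g \<and>
     (\<forall>\<phi>. test_fun \<phi> \<longrightarrow>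
        (\<integral>x. f x * dpart [i] \<phi> x \<partial>lborel) = - (\<integral>x. g x * \<phi> x \<partial>lborel))"

definition weak_grad_L2loc :: "(real^2 \<Rightarrow> real^3) \<Rightarrow> (2 \<Rightarrow> real^2 \<Rightarrow> real^3) \<Rightarrow> bool" where
  "weak_grad_L2loc n d \<longleftrightarrow>
     (\<forall>i k. weak_partial i (\<lambda>x. n x $ k) (\<lambda>x. d i x $ k) \<and> loc_L2 (\<lambda>x. d i x $ k))"

definition sphere_map :: "(real^2 \<Rightarrow> real^3) \<Rightarrow> bool" where
  "sphere_map n \<longleftrightarrow> (\<forall>x. norm (n x) = 1)"

text \<open>curl of n computed from the weak derivatives d 1 = d_1 n, d 2 = d_2 n.\<close>
definition curl :: "(2 \<Rightarrow> real^2 \<Rightarrow> real^3) \<Rightarrow> real^2 \<Rightarrow> real^3" where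
  "curl d x = vector [d 2 x $ 3, - (d 1 x $ 3), d 1 x $ 2 - d 2 x $ 1]"

definition Dir :: "(2 \<Rightarrow> real^2 \<Rightarrow> real^3) \<Rightarrow> real" where
  "Dir d = (1/2) * (\<integral>x. (norm (d 1 x))\<^sup>2 + (norm (d 2 x))\<^sup>2 \<partial>lborel)"

definition Hel :: "(real^2 \<Rightarrow> real^3) \<Rightarrow> (2 \<Rightarrow> real^2 \<Rightarrow> real^3) \<Rightarrow> real" where
  "Hel n d = (\<integral>x. (n x - e3) \<bullet> curl d x \<partial>lborel)"

definition Pot :: "(real^2 \<Rightarrow> real^3) \<Rightarrow> real" where
  "Pot n = (1/8) * (\<integral>x. (norm (n x - e3)) ^ 4 \<partial>lborel)"

definition energy :: "real \<Rightarrow> (real^2 \<Rightarrow> real^3) \<Rightarrow> (2 \<Rightarrow> real^2 \<Rightarrow> real^3) \<Rightarrow> real" where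
  "energy r n d = Dir d + r * Hel n d + Pot n"

definition in_M :: "(real^2 \<Rightarrow> real^3) \<Rightarrow> (2 \<Rightarrow> real^2 \<Rightarrow> real^3) \<Rightarrow> bool" where
  "in_M n d \<longleftrightarrow> sphere_map n \<and> n \<in> borel_measurable lborel \<and> weak_grad_L2loc n d \<and>
     (\<integral>\<^sup>+ x. ennreal ((norm (d 1 x))\<^sup>2 + (norm (d 2 x))\<^sup>2) \<partial>lborel) < \<infinity> \<and>
     (\<integral>\<^sup>+ x. ennreal ((norm (n x - e3)) ^ 4) \<partial>lborel) < \<infinity>"

definition L2dist_sq :: "(real^2 \<Rightarrow> real^3) \<Rightarrow> ennreal" where
  "L2dist_sq n = (\<integral>\<^sup>+ x. ennreal ((norm (n x - e3))\<^sup>2) \<partial>lborel)"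

end

theory Submission
  imports Defs
begin

text \<open>
  With \<open>m = n - e\<^sub>3\<close>, the constraint \<open>|n| = 1\<close> gives \<open>m\<^sub>3 = - |m|\<^sup>2 / 2\<close> and
  \<open>n \<bullet> \<partial>\<^sub>i n = 0\<close>, that is \<open>\<partial>\<^sub>i n\<^sub>3 = - m \<bullet> \<partial>\<^sub>i n\<close>. Hence every term of the helicity
  density is of order \<open>|m|\<^sup>2 |\<nabla>n|\<close>, and applying the Gagliardo argument to
  \<open>1 - n\<^sub>3 = |m|\<^sup>2 / 2\<close>, whose gradient is bounded by \<open>|m| |\<nabla>n|\<close>, yields the
  Ladyzhenskaya-type bound \<open>\<integral>|m|\<^sup>4 \<le> 2 \<integral>|m|\<^sup>2 \<integral>|\<nabla>n|\<^sup>2\<close>. Together,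
  \<open>|H| \<le> 6 \<delta> D\<close> whenever the \<open>L\<^sup>2\<close> norm of \<open>m\<close> is at most \<open>\<delta>\<close>, so for \<open>\<delta> = 1 / (6 r)\<close>
  the helicity is absorbed by \<open>D\<close> and \<open>V > 0\<close> remains.

  Weak derivatives are handled without mollification: tested against bumps that increase to
  indicators of boxes, they satisfy \<open>u(x + h e\<^sub>i) - u(x) = \<integral>\<^sub>0\<^sup>h \<partial>\<^sub>i u(x + t e\<^sub>i) dt\<close> for almost every \<open>x\<close>,
  and all product rules are read off from difference quotients.
\<close>

section \<open>Smooth bumps on boxes\<close>

text \<open>The span of these functions contains \<open>exp (- 1 / x)\<close>, extended by zero, and is closed under
  differentiation.\<close>

definition flat :: "nat \<Rightarrow> real \<Rightarrow> real" where
  "flat k x = (if x > 0 then inverse x ^ k * exp (- inverse x) else 0)"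

lemma power_le_fact_exp:
  fixes y :: real
  assumes "y \<ge> 0"
  shows "y ^ n \<le> fact n * exp y"
proof -
  have "(\<Sum>k\<in>{n}. y ^ k /\<^sub>R fact k) \<le> (\<Sum>k. y ^ k /\<^sub>R fact k)"
    using assms by (intro sum_le_suminf summable_exp_generic) auto
  then have "y ^ n / fact n \<le> exp y"
    by (simp add: exp_def divide_inverse mult.commute)
  then show ?thesis by (simp add: field_simps)
qed

text \<open>The exponential bound is applied to the power \<open>k + 2\<close> of
  \<open>inverse x\<close>. The two extra powers leave a quadratic bound near the origin, one order
  more than a zero derivative there requires.\<close>

lemma abs_flat_le: "\<bar>flat k x\<bar> \<le> fact (k + 2) * x\<^sup>2"
proof (cases "x > 0")
  case True
  have "inverse x ^ (k + 2) \<le> fact (k + 2) * exp (inverse x)"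
    using True by (intro power_le_fact_exp) simp
  then have "inverse x ^ k * exp (- inverse x) \<le> fact (k + 2) * x\<^sup>2"
    using True by (simp add: field_simps exp_minus power_add power2_eq_square)
  then show ?thesis using True by (simp add: flat_def)
qed (simp add: flat_def)

text \<open>Right of the origin this is the product rule, left of it everything vanishes. At the
  origin the difference quotient is at most a multiple of \<open>\<bar>h\<bar>\<close> by
  \<open>abs_flat_le\<close>, and the right-hand side is 0 there as well.\<close>

lemma flat_has_derivative:
  "(flat k has_real_derivative (flat (k + 2) x - real k * flat (k + 1) x)) (at x)"
proof -
  consider "x > 0" | "x < 0" | "x = 0" by linarith
  then show ?thesis
  proof cases
    case 1
    have "((\<lambda>x. inverse x ^ k * exp (- inverse x)) has_real_derivative
        (flat (k + 2) x - real k * flat (k + 1) x)) (at x)"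
    proof (cases k)
      case 0
      then show ?thesis using 1
        by (auto intro!: derivative_eq_intros simp: flat_def power2_eq_square)
    next
      case (Suc m)
      have inv: "(inverse has_real_derivative - (inverse x ^ 2)) (at x)"
        using DERIV_inverse[of x] 1 by (simp add: power2_eq_square)
      have "((\<lambda>x. exp (- inverse x)) has_real_derivative exp (- inverse x) * - (- (inverse x ^ 2))) (at x)"
        by (rule DERIV_fun_exp[OF DERIV_minus[OF inv]])
      from DERIV_mult[OF DERIV_power_Suc[OF inv, of m] this] show ?thesis
        unfolding Suc by (rule DERIV_cong) (use 1 in \<open>simp add: flat_def algebra_simps power2_eq_square\<close>)
    qed
    then show ?thesis
      by (rule has_field_derivative_transform_within_open[where S="{0<..}"])
        (use 1 in \<open>auto simp: flat_def\<close>)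
  next
    case 2
    have "((\<lambda>x. 0) has_real_derivative (flat (k + 2) x - real k * flat (k + 1) x)) (at x)"
      using 2 by (simp add: flat_def)
    then show ?thesis
      by (rule has_field_derivative_transform_within_open[where S="{..<0}"])
        (use 2 in \<open>auto simp: flat_def\<close>)
  next
    case 3
    have "((\<lambda>h. flat k h / h) \<longlongrightarrow> 0) (at 0)"
    proof (rule Lim_null_comparison)
      have "\<bar>flat k h / h\<bar> \<le> fact (k + 2) * \<bar>h\<bar>" for h
      proof (cases "h = 0")
        case False
        have "\<bar>flat k h\<bar> / \<bar>h\<bar> \<le> fact (k + 2) * h\<^sup>2 / \<bar>h\<bar>"
          by (intro divide_right_mono abs_flat_le) simp
        also have "\<dots> = fact (k + 2) * \<bar>h\<bar>"
          using False by (simp add: power2_eq_square abs_if)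
        finally show ?thesis by simp
      qed simp
      then show "\<forall>\<^sub>F h in at 0. norm (flat k h / h) \<le> fact (k + 2) * \<bar>h\<bar>"
        by simp
      show "((\<lambda>h::real. fact (k + 2) * \<bar>h\<bar>) \<longlongrightarrow> 0) (at 0)"
        by (auto intro!: tendsto_eq_intros)
    qed
    then show ?thesis
      using 3 by (simp add: DERIV_def) (simp add: flat_def)
  qed
qed

lemma flat_0_bounds: "0 \<le> flat 0 x" "flat 0 x \<le> 1"
  by (auto simp: flat_def)

text \<open>This closure is stable under partial differentiation. The condition
  \<open>smooth_fn\<close>, which quantifies over all iterated partial derivatives, then reduces to
  first-order differentiability of its members by induction on the list of directions.\<close>

inductive_set flat_algebra :: "(real^2 \<Rightarrow> real) set" where
  base: "(\<lambda>x. flat k (a + b * x $ i)) \<in> flat_algebra"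
| smult: "f \<in> flat_algebra \<Longrightarrow> (\<lambda>x. c * f x) \<in> flat_algebra"
| add: "f \<in> flat_algebra \<Longrightarrow> g \<in> flat_algebra \<Longrightarrow> (\<lambda>x. f x + g x) \<in> flat_algebra"
| mult: "f \<in> flat_algebra \<Longrightarrow> g \<in> flat_algebra \<Longrightarrow> (\<lambda>x. f x * g x) \<in> flat_algebra"

text \<open>\<open>dpart\<close> is built on \<open>frechet_derivative\<close>, so the induction
  carries a full derivative together with membership of all partial derivatives. The base case is
  the chain rule, and products use the Leibniz rule.\<close>

lemma flat_algebra_derivative:
  assumes "f \<in> flat_algebra"
  shows "\<exists>f'. (\<forall>x. (f has_derivative f' x) (at x)) \<and> (\<forall>j. (\<lambda>x. f' x (axis j 1)) \<in> flat_algebra)"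
  using assms
proof induction
  case (base k a b i)
  define q where "q y = flat (k + 2) y - real k * flat (k + 1) y" for y
  have D: "((\<lambda>x. flat k (a + b * x $ i)) has_derivative (\<lambda>v. b * v $ i * q (a + b * x $ i))) (at x)"
    for x :: "real^2"
  proof -
    have "((\<lambda>x::real^2. a + b * x $ i) has_derivative (\<lambda>v. b * v $ i)) (at x)"
      by (auto intro!: derivative_eq_intros bounded_linear.has_derivative[OF bounded_linear_vec_nth])
    from DERIV_compose_FDERIV[OF flat_has_derivative this] show ?thesis
      by (simp add: q_def)
  qed
  have "(\<lambda>x. b * (axis j 1 :: real^2) $ i * q (a + b * x $ i)) \<in> flat_algebra" for j
  proof -
    have "(\<lambda>x. b * (axis j 1 :: real^2) $ i * (flat (k + 2) (a + b * x $ i)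
        + (- real k) * flat (k + 1) (a + b * x $ i))) \<in> flat_algebra"
      by (intro flat_algebra.intros)
    then show ?thesis by (simp add: q_def)
  qed
  with D show ?case
    by (intro exI[of _ "\<lambda>x v. b * v $ i * q (a + b * x $ i)"]) blast
next
  case (smult f c)
  then obtain f' where "\<And>x. (f has_derivative f' x) (at x)"
    "\<And>j. (\<lambda>x. f' x (axis j 1)) \<in> flat_algebra" by blast
  then show ?case
    by (intro exI[of _ "\<lambda>x v. c * f' x v"])
      (auto intro: flat_algebra.smult has_derivative_mult_right)
next
  case (add f g)
  then obtain f' g' where "\<And>x. (f has_derivative f' x) (at x)" "\<And>x. (g has_derivative g' x) (at x)"
    "\<And>j. (\<lambda>x. f' x (axis j 1)) \<in> flat_algebra" "\<And>j. (\<lambda>x. g' x (axis j 1)) \<in> flat_algebra" by blast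
  then show ?case
    by (intro exI[of _ "\<lambda>x v. f' x v + g' x v"])
      (auto intro: flat_algebra.add has_derivative_add)
next
  case (mult f g)
  then obtain f' g' where D: "\<And>x. (f has_derivative f' x) (at x)" "\<And>x. (g has_derivative g' x) (at x)"
    and alg: "\<And>j. (\<lambda>x. f' x (axis j 1)) \<in> flat_algebra" "\<And>j. (\<lambda>x. g' x (axis j 1)) \<in> flat_algebra" by blast
  have "(\<lambda>x. f x * g' x (axis j 1) + f' x (axis j 1) * g x) \<in> flat_algebra" for j
    by (rule flat_algebra.add[OF flat_algebra.mult[OF mult.hyps(1) alg(2)]
          flat_algebra.mult[OF alg(1) mult.hyps(2)]])
  moreover have "((\<lambda>x. f x * g x) has_derivative (\<lambda>v. f x * g' x v + f' x v * g x)) (at x)" for x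
    by (rule has_derivative_mult[OF D])
  ultimately show ?case
    by (intro exI[of _ "\<lambda>x v. f x * g' x v + f' x v * g x"] conjI allI)
qed

lemma flat_algebra_differentiable:
  assumes "f \<in> flat_algebra"
  shows "f differentiable_on UNIV"
    and "(\<lambda>x. frechet_derivative f (at x) (axis j 1)) \<in> flat_algebra"
    and "f differentiable (at x)"
    and "continuous_on A f"
proof -
  obtain f' where f': "\<And>x. (f has_derivative f' x) (at x)"
    "\<And>j. (\<lambda>x. f' x (axis j 1)) \<in> flat_algebra"
    using flat_algebra_derivative[OF assms] by blast
  show "f differentiable (at x)" for x
    using f'(1) by (auto simp: differentiable_def)
  then show "f differentiable_on UNIV" "continuous_on A f"
    by (auto simp: differentiable_on_def intro: differentiable_imp_continuous_within
        continuous_at_imp_continuous_on)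
  have "frechet_derivative f (at x) = f' x" for x
    using frechet_derivative_at[OF f'(1)] by simp
  then show "(\<lambda>x. frechet_derivative f (at x) (axis j 1)) \<in> flat_algebra"
    using f'(2) by simp
qed

lemma smooth_fn_flat_algebra:
  assumes "f \<in> flat_algebra"
  shows "smooth_fn f"
proof -
  have "dpart is f \<in> flat_algebra" for "is"
    using assms by (induction "is") (auto intro: flat_algebra_differentiable)
  then show ?thesis
    by (auto simp: smooth_fn_def intro: flat_algebra_differentiable)
qed

text \<open>A tensor product with one factor for each side of the box. For \<open>k > 0\<close> a
  factor vanishes beyond its side, and growing \<open>k\<close> steepens it towards the indicator of
  a half-line.\<close>

definition bump :: "real \<Rightarrow> real^2 \<Rightarrow> real^2 \<Rightarrow> real^2 \<Rightarrow> real" where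
  "bump k c d x = flat 0 (k * (x $ 1 - c $ 1)) * flat 0 (k * (d $ 1 - x $ 1))
     * (flat 0 (k * (x $ 2 - c $ 2)) * flat 0 (k * (d $ 2 - x $ 2)))"

lemma bump_in_flat_algebra: "bump k c d \<in> flat_algebra"
proof -
  have factor: "(\<lambda>x. flat 0 (k * (x $ i - a))) \<in> flat_algebra" "(\<lambda>x. flat 0 (k * (a - x $ i))) \<in> flat_algebra"
    for a and i :: 2
    using flat_algebra.base[of 0 "- k * a" k i] flat_algebra.base[of 0 "k * a" "- k" i]
    by (simp_all add: algebra_simps)
  show ?thesis
    unfolding bump_def[abs_def]
    by (rule flat_algebra.mult[OF flat_algebra.mult[OF factor] flat_algebra.mult[OF factor]])
qed

lemma bump_bounds: "0 \<le> bump k c d x" "bump k c d x \<le> 1"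
  by (simp_all add: bump_def flat_0_bounds mult_le_one)

text \<open>Translates stay inside the family, so the weak derivative never has to be tested against
  anything but bumps.\<close>

lemma bump_translate: "bump k c d (x - v) = bump k (c + v) (d + v) x"
  by (simp add: bump_def algebra_simps)

lemma bump_support:
  assumes "k > 0" "x \<notin> box c d"
  shows "bump k c d x = 0"
proof -
  have "(x $ 1 \<le> c $ 1 \<or> d $ 1 \<le> x $ 1) \<or> (x $ 2 \<le> c $ 2 \<or> d $ 2 \<le> x $ 2)"
    using assms(2) by (auto simp: mem_box_cart forall_2 not_less)
  then show ?thesis
    using assms(1) by (auto simp: bump_def flat_def zero_less_mult_iff)
qed

lemma test_fun_bump:
  assumes "k > 0"
  shows "test_fun (bump k c d)"
  unfolding test_fun_def
proof
  show "smooth_fn (bump k c d)"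
    by (intro smooth_fn_flat_algebra bump_in_flat_algebra)
  have "closure {x. bump k c d x \<noteq> 0} \<subseteq> cbox c d"
    using bump_support[OF assms, of _ c d] box_subset_cbox[of c d]
    by (intro closure_minimal) auto
  then show "compact (closure {x. bump k c d x \<noteq> 0})"
    by (simp add: compact_eq_bounded_closed bounded_subset[OF bounded_cbox])
qed

lemma bump_tendsto_indicator:
  "(\<lambda>m. bump (real (Suc m)) c d x) \<longlonglongrightarrow> indicator (box c d) x"
proof (cases "x \<in> box c d")
  case False
  then show ?thesis by (simp add: bump_support del: of_nat_Suc)
next
  case True
  \<comment> \<open>For \<open>y > 0\<close> the factor is \<open>exp (- 1 / ((m + 1) * y))\<close>,
    whose exponent tends to 0. \<open>Suc m\<close> keeps the scale positive from the start.\<close>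
  have *: "(\<lambda>m. flat 0 (real (Suc m) * y)) \<longlonglongrightarrow> 1" if "y > 0" for y
  proof -
    have "(\<lambda>m. exp (- (inverse (real (Suc m)) * inverse y))) \<longlonglongrightarrow> exp (- (0 * inverse y))"
      by (intro tendsto_intros LIMSEQ_inverse_real_of_nat)
    then show ?thesis using that by (simp add: flat_def del: of_nat_Suc)
  qed
  have "(\<lambda>m. bump (real (Suc m)) c d x) \<longlonglongrightarrow> 1 * 1 * (1 * 1)"
    unfolding bump_def using True by (intro tendsto_mult *) (auto simp: mem_box_cart)
  then show ?thesis using True by simp
qed

section \<open>The fundamental lemma of the calculus of variations\<close>

lemma nn_integral_translate:
  fixes v :: "'a::euclidean_space"
  assumes [measurable]: "f \<in> borel_measurable lborel"
  shows "(\<integral>\<^sup>+x. f (x + v) \<partial>lborel) = (\<integral>\<^sup>+x. f x \<partial>lborel)"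
proof -
  have "(\<integral>\<^sup>+x. f x \<partial>lborel) = (\<integral>\<^sup>+x. f x \<partial>distr lborel borel ((+) v))"
    by (simp add: lborel_distr_plus)
  also have "\<dots> = (\<integral>\<^sup>+x. f (v + x) \<partial>lborel)"
    using assms by (subst nn_integral_distr) auto
  finally show ?thesis by (simp add: add.commute)
qed

lemma integral_translate:
  fixes v :: "'a::euclidean_space" and f :: "'a \<Rightarrow> real"
  assumes [measurable]: "f \<in> borel_measurable lborel"
  shows "(\<integral>x. f (x + v) \<partial>lborel) = (\<integral>x. f x \<partial>lborel)"
proof -
  have "(\<integral>x. f x \<partial>lborel) = (\<integral>x. f x \<partial>distr lborel borel ((+) v))"
    by (simp add: lborel_distr_plus)
  also have "\<dots> = (\<integral>x. f (v + x) \<partial>lborel)"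
    using assms by (subst integral_distr) auto
  finally show ?thesis by (simp add: add.commute)
qed

lemma loc_L1_integrable_mult:
  assumes "loc_L1 g" and [measurable]: "\<phi> \<in> borel_measurable lborel"
    and bound: "\<And>x. \<bar>\<phi> x\<bar> \<le> C" and "bounded K" and supp: "\<And>x. x \<notin> K \<Longrightarrow> \<phi> x = 0"
  shows "integrable lborel (\<lambda>x. g x * \<phi> x)"
proof (rule integrableI_bounded)
  have [measurable]: "g \<in> borel_measurable lborel"
    using assms by (auto simp: loc_L1_def)
  show "(\<lambda>x. g x * \<phi> x) \<in> borel_measurable lborel" by measurable
  have C: "0 \<le> C" using bound[of 0] by linarith
  \<comment> \<open>\<open>K\<close> is merely bounded, whereas \<open>loc_L1\<close> speaks of
    compact sets, hence the passage to the closure.\<close>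
  have "(\<integral>\<^sup>+x. norm (g x * \<phi> x) \<partial>lborel) \<le> (\<integral>\<^sup>+x. ennreal C * (ennreal \<bar>g x\<bar> * indicator (closure K) x) \<partial>lborel)"
  proof (intro nn_integral_mono)
    fix x
    show "ennreal (norm (g x * \<phi> x)) \<le> ennreal C * (ennreal \<bar>g x\<bar> * indicator (closure K) x)"
    proof (cases "x \<in> closure K")
      case True
      have "norm (g x * \<phi> x) \<le> C * \<bar>g x\<bar>"
        using mult_right_mono[OF bound[of x], of "\<bar>g x\<bar>"] by (simp add: abs_mult mult.commute)
      then show ?thesis using True C by (simp add: ennreal_mult[symmetric] ennreal_leI)
    next
      case False
      then show ?thesis using supp[of x] closure_subset[of K] by auto
    qed
  qed
  also have "\<dots> = ennreal C * (\<integral>\<^sup>+x\<in>closure K. ennreal \<bar>g x\<bar> \<partial>lborel)"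
    by (intro nn_integral_cmult) measurable
  also have "\<dots> < \<infinity>"
    using assms by (auto simp: loc_L1_def ennreal_mult_less_top compact_closure)
  finally show "(\<integral>\<^sup>+x. norm (g x * \<phi> x) \<partial>lborel) < \<infinity>" .
qed

text \<open>The positive and negative parts of \<open>g\<close> serve as densities of two measures.
  These agree and are finite on boxes, an intersection-stable generator of the Borel sets, so they
  coincide, and then so do the densities almost everywhere.\<close>

lemma AE_zero_if_box_integrals_zero:
  fixes g :: "'a::euclidean_space \<Rightarrow> real"
  assumes int: "\<And>c d. integrable lborel (\<lambda>x. g x * indicator (box c d) x)"
    and zero: "\<And>c d. (\<integral>x. g x * indicator (box c d) x \<partial>lborel) = 0"
    and [measurable]: "g \<in> borel_measurable lborel"
  shows "AE x in lborel. g x = 0"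
proof -
  let ?p = "density lborel (\<lambda>x. ennreal (g x))" and ?n = "density lborel (\<lambda>x. ennreal (- g x))"
  have em: "emeasure ?p (box c d) = (\<integral>\<^sup>+x. ennreal (g x * indicator (box c d) x) \<partial>lborel)"
    "emeasure ?n (box c d) = (\<integral>\<^sup>+x. ennreal (- (g x * indicator (box c d) x)) \<partial>lborel)" for c d
    by (subst emeasure_density; (simp add: borel_open)?; intro nn_integral_cong; simp split: split_indicator)+
  have fin: "emeasure ?p (box c d) \<noteq> \<infinity>" "emeasure ?n (box c d) \<noteq> \<infinity>" for c d
    unfolding em using int[of c d] by (simp_all add: real_integrable_def)
  have eq: "emeasure ?p (box c d) = emeasure ?n (box c d)" for c d
  proof -
    have "enn2real (emeasure ?p (box c d)) = enn2real (emeasure ?n (box c d))"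
      using zero[of c d] unfolding real_lebesgue_integral_def[OF int] em by simp
    moreover have "ennreal (enn2real (emeasure M (box c d))) = emeasure M (box c d)"
      if "M = ?p \<or> M = ?n" for M
      using that fin[of c d] by (auto simp: less_top)
    ultimately show ?thesis by metis
  qed
  have "?p = ?n"
  proof (rule measure_eqI_generator_eq[where E="range (\<lambda>(a, b). box a b)" and \<Omega>=UNIV
        and A="\<lambda>n::nat. box (- (real n *\<^sub>R One)) (real n *\<^sub>R One)"])
    show "Int_stable (range (\<lambda>(a, b). box a b :: 'a set))"
      by (auto simp: Int_stable_def box_Int_box)
    show "sets ?p = sigma_sets UNIV (range (\<lambda>(a, b). box a b))"
      "sets ?n = sigma_sets UNIV (range (\<lambda>(a, b). box a b))"
      by (simp_all add: borel_eq_box)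
    show "(\<Union>n::nat. box (- (real n *\<^sub>R One)) (real n *\<^sub>R One)) = (UNIV :: 'a set)"
      by (rule UN_box_eq_UNIV)
  qed (use eq fin in auto)
  \<comment> \<open>\<open>ennreal\<close> truncates negative reals to 0, so the two sides are the
    positive and the negative part of \<open>g x\<close>. At most one of them is nonzero, and
    equality forces both to vanish.\<close>
  then have "AE x in lborel. ennreal (g x) = ennreal (- g x)"
    by (intro sigma_finite_measure.density_unique[OF lborel.sigma_finite_measure_axioms]) auto
  then show ?thesis
  proof eventually_elim
    case (elim x)
    then show "g x = 0"
      by (cases "g x \<ge> 0") (auto simp: ennreal_neg ennreal_eq_0_iff dest: sym)
  qed
qed

lemma bump_measurable [measurable]: "bump k c d \<in> borel_measurable borel"
  by (intro borel_measurable_continuous_onI flat_algebra_differentiable(4)[OF bump_in_flat_algebra])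

lemma loc_L1_integrable_bump:
  assumes "loc_L1 g" "k > 0"
  shows "integrable lborel (\<lambda>x. g x * bump k c d x)"
  by (rule loc_L1_integrable_mult[where C=1 and K="box c d"])
    (use assms bump_bounds bump_support in auto)

text \<open>Bumps lie below the indicator of their box and converge to it, so dominated convergence
  carries the vanishing over to all boxes.\<close>

lemma fundamental_lemma_bump:
  assumes g: "loc_L1 g"
    and zero: "\<And>k c d. k > 0 \<Longrightarrow> (\<integral>x. g x * bump k c d x \<partial>lborel) = 0"
  shows "AE x in lborel. g x = 0"
proof (rule AE_zero_if_box_integrals_zero)
  show [measurable]: "g \<in> borel_measurable lborel"
    using g by (simp add: loc_L1_def)
  show int: "integrable lborel (\<lambda>x. g x * indicator (box c d) x)" for c d
    by (rule loc_L1_integrable_mult[where C=1 and K="box c d"])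
      (use g in \<open>auto simp: indicator_def\<close>)
  show "(\<integral>x. g x * indicator (box c d) x \<partial>lborel) = 0" for c d
  proof (rule LIMSEQ_unique)
    show "(\<lambda>m. \<integral>x. g x * bump (real (Suc m)) c d x \<partial>lborel) \<longlonglongrightarrow> (\<integral>x. g x * indicator (box c d) x \<partial>lborel)"
    proof (rule integral_dominated_convergence[where w="\<lambda>x. \<bar>g x * indicator (box c d) x\<bar>"])
      show "AE x in lborel. (\<lambda>m. g x * bump (real (Suc m)) c d x) \<longlonglongrightarrow> g x * indicator (box c d) x"
        by (intro AE_I2 tendsto_mult_left bump_tendsto_indicator)
      show "AE x in lborel. norm (g x * bump (real (Suc m)) c d x) \<le> \<bar>g x * indicator (box c d) x\<bar>" for m
        using bump_bounds[of "real (Suc m)" c d] bump_support[of "real (Suc m)" _ c d]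
        by (auto simp: abs_mult indicator_def mult_left_le simp del: of_nat_Suc)
    qed (use int in auto)
    show "(\<lambda>m. \<integral>x. g x * bump (real (Suc m)) c d x \<partial>lborel) \<longlonglongrightarrow> 0"
      by (simp add: zero)
  qed
qed

section \<open>Weak derivatives along lines\<close>

lemma bump_has_derivative:
  "(bump k c d has_derivative frechet_derivative (bump k c d) (at x)) (at x)"
  using flat_algebra_differentiable(3)[OF bump_in_flat_algebra] frechet_derivative_works by blast

lemma dpart_bump_continuous: "continuous_on A (dpart [i] (bump k c d))"
  using flat_algebra_differentiable(2)[OF bump_in_flat_algebra] flat_algebra_differentiable(4) by simp

lemma dpart_bump_measurable [measurable]: "dpart [i] (bump k c d) \<in> borel_measurable borel"
  by (intro borel_measurable_continuous_onI dpart_bump_continuous)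

text \<open>The closed box has an open complement, so outside it the bump vanishes on a whole
  neighbourhood of \<open>x\<close>.\<close>

lemma dpart_bump_support:
  assumes "k > 0" "x \<notin> cbox c d"
  shows "dpart [i] (bump k c d) x = 0"
proof -
  have "(bump k c d has_derivative (\<lambda>_. 0)) (at x)"
    by (rule has_derivative_transform_within_open[where f="\<lambda>_. 0" and s="- cbox c d"])
      (use assms bump_support[OF assms(1)] box_subset_cbox[of c d] in auto)
  from frechet_derivative_at[OF this, symmetric] show ?thesis by simp
qed

lemma dpart_bump_bounded:
  assumes "k > 0"
  obtains C where "C \<ge> 0" "\<And>x. \<bar>dpart [i] (bump k c d) x\<bar> \<le> C"
proof -
  have "bounded (dpart [i] (bump k c d) ` cbox c d)"
    by (intro compact_imp_bounded compact_continuous_image dpart_bump_continuous compact_cbox)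
  then obtain C where C: "\<And>x. x \<in> cbox c d \<Longrightarrow> \<bar>dpart [i] (bump k c d) x\<bar> \<le> C"
    by (auto simp: bounded_iff)
  have "\<bar>dpart [i] (bump k c d) x\<bar> \<le> max C 0" for x
    using C[of x] dpart_bump_support[OF assms, of x c d i] by (cases "x \<in> cbox c d") auto
  then show ?thesis using that[of "max C 0"] by auto
qed

lemma dpart_bump_translate:
  "dpart [i] (bump k (c + v) (d + v)) x = dpart [i] (bump k c d) (x - v)"
proof -
  have "((\<lambda>y. bump k c d (y - v)) has_derivative
      (\<lambda>w. frechet_derivative (bump k c d) (at (x - v)) w)) (at x)"
    by (rule has_derivative_compose[OF _ bump_has_derivative])
      (auto intro!: derivative_eq_intros)
  from frechet_derivative_at[OF this] show ?thesis
    by (simp add: bump_translate[abs_def])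
qed

text \<open>The line runs backwards because a forward translation of \<open>u\<close> under the
  integral becomes a backward translation of the bump. This is the source of the minus sign.\<close>

lemma bump_FTC:
  assumes "h \<ge> 0"
  shows "bump k c d (x - h *\<^sub>R axis i 1) - bump k c d x
    = (\<integral>t. indicator {0..h} t * - dpart [i] (bump k c d) (x - t *\<^sub>R axis i 1) \<partial>lborel)"
proof -
  have "((\<lambda>t. bump k c d (x - t *\<^sub>R axis i 1)) has_vector_derivative
      - dpart [i] (bump k c d) (x - t *\<^sub>R axis i 1)) (at t within {0..h})" for t
  proof -
    let ?D = "frechet_derivative (bump k c d) (at (x - t *\<^sub>R axis i 1))"
    have "((\<lambda>t. bump k c d (x - t *\<^sub>R axis i 1)) has_derivative
        (\<lambda>s. ?D (- (s *\<^sub>R axis i 1)))) (at t within {0..h})"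
      by (rule has_derivative_compose[OF _ bump_has_derivative])
        (auto intro!: derivative_eq_intros)
    moreover have "?D (- (s *\<^sub>R axis i 1)) = s *\<^sub>R - ?D (axis i 1)" for s
      using bump_has_derivative[of k c d, THEN has_derivative_linear]
      by (simp add: linear_neg linear_cmul)
    ultimately show ?thesis
      by (simp add: has_vector_derivative_def)
  qed
  moreover have "continuous_on {0..h} (\<lambda>t. - dpart [i] (bump k c d) (x - t *\<^sub>R axis i 1))"
    by (intro continuous_intros continuous_on_compose2[OF dpart_bump_continuous[of UNIV]]) auto
  ultimately show ?thesis
    using integral_FTC_atLeastAtMost[OF assms, of "\<lambda>t. bump k c d (x - t *\<^sub>R axis i 1)"
        "\<lambda>t. - dpart [i] (bump k c d) (x - t *\<^sub>R axis i 1)"] by simp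
qed

lemma bump_Lipschitz:
  assumes "h \<ge> 0" and C: "\<And>x. \<bar>dpart [i] (bump k c d) x\<bar> \<le> C"
  shows "\<bar>bump k c d (x - h *\<^sub>R axis i 1) - bump k c d x\<bar> \<le> h * C"
proof -
  have "\<bar>bump k c d (x - h *\<^sub>R axis i 1) - bump k c d x\<bar>
      \<le> (\<integral>t. indicator {0..h} t * C \<partial>lborel)"
    unfolding bump_FTC[OF assms(1)]
  proof (rule order_trans[OF integral_abs_bound integral_mono'])
    show "integrable lborel (\<lambda>t. indicator {0..h} t * C)"
      using assms(1) by (intro integrable_mult_left) auto
    show "\<bar>indicator {0..h} t * - dpart [i] (bump k c d) (x - t *\<^sub>R axis i 1)\<bar> \<le> indicator {0..h} t * C" for t
      using C[of "x - t *\<^sub>R axis i 1"] by (simp add: abs_mult mult_left_mono)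
    show "0 \<le> indicator {0..h} t * C" for t :: real
      using C[of x] by simp
  qed
  then show ?thesis using assms(1) by simp
qed

section \<open>Integrability over strips, and local integrability of translates and line
  integrals\<close>

lemma integrable_pair_strip:
  fixes G :: "'a::euclidean_space \<Rightarrow> real \<Rightarrow> real"
  assumes [measurable]: "(\<lambda>(x, t). G x t) \<in> borel_measurable (lborel \<Otimes>\<^sub>M lborel)"
    and bound: "\<And>t. 0 \<le> t \<Longrightarrow> t \<le> h \<Longrightarrow> (\<integral>\<^sup>+x. ennreal \<bar>G x t\<bar> \<partial>lborel) \<le> ennreal C"
  shows "integrable (lborel \<Otimes>\<^sub>M lborel) (\<lambda>(x, t). indicator {0..h} t * G x t)"
proof (rule integrableI_bounded)
  show "(\<lambda>(x, t). indicator {0..h} t * G x t) \<in> borel_measurable (lborel \<Otimes>\<^sub>M lborel)"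
    by measurable
  \<comment> \<open>By Tonelli the integral over \<open>x\<close> comes first. Its bound is uniform
    in \<open>t\<close>, and the strip has finite length.\<close>
  have "(\<integral>\<^sup>+z. ennreal (norm (case z of (x, t) \<Rightarrow> indicator {0..h} t * G x t)) \<partial>(lborel \<Otimes>\<^sub>M lborel))
      = (\<integral>\<^sup>+t. \<integral>\<^sup>+x. ennreal (norm (indicator {0..h} t * G x t)) \<partial>lborel \<partial>lborel)"
    by (subst lborel_pair.nn_integral_snd[symmetric]) auto
  also have "\<dots> \<le> (\<integral>\<^sup>+t. ennreal C * indicator {0..h} t \<partial>lborel)"
    using bound by (intro nn_integral_mono) (auto simp: indicator_def)
  also have "\<dots> = ennreal C * emeasure lborel {0..h}"
    by (intro nn_integral_cmult_indicator) auto
  also have "\<dots> < \<infinity>"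
    by (auto simp: ennreal_mult_less_top emeasure_lborel_Icc_eq)
  finally show "(\<integral>\<^sup>+z. ennreal (norm (case z of (x, t) \<Rightarrow> indicator {0..h} t * G x t)) \<partial>(lborel \<Otimes>\<^sub>M lborel)) < \<infinity>" .
qed

text \<open>Shifts of \<open>K\<close> by at most \<open>h\<close> along a unit vector stay in one
  ball of radius \<open>R + h\<close>. Translation invariance then bounds every integral by the mass
  of \<open>f\<close> on that ball.\<close>

lemma loc_L1_translate_bound:
  assumes "loc_L1 f" "bounded K"
  obtains C where "\<And>t. 0 \<le> t \<Longrightarrow> t \<le> h \<Longrightarrow>
    (\<integral>\<^sup>+x. ennreal \<bar>f (x + t *\<^sub>R axis i 1)\<bar> * indicator K x \<partial>lborel) \<le> ennreal C"
proof -
  have [measurable]: "f \<in> borel_measurable lborel"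
    using assms by (auto simp: loc_L1_def)
  obtain R where "\<forall>x\<in>K. norm x \<le> R"
    using assms(2) bounded_iff by blast
  then have R: "K \<subseteq> cball 0 R" by auto
  have [measurable]: "cball 0 (R + h) \<in> sets (borel :: (real^2) measure)"
    by simp
  let ?I = "\<integral>\<^sup>+x\<in>cball 0 (R + h). ennreal \<bar>f x\<bar> \<partial>lborel"
  have "(\<integral>\<^sup>+x. ennreal \<bar>f (x + t *\<^sub>R axis i 1)\<bar> * indicator K x \<partial>lborel) \<le> ?I"
    if "0 \<le> t" "t \<le> h" for t
  proof -
    have "(\<integral>\<^sup>+x. ennreal \<bar>f (x + t *\<^sub>R axis i 1)\<bar> * indicator K x \<partial>lborel)
        \<le> (\<integral>\<^sup>+x. ennreal \<bar>f (x + t *\<^sub>R axis i 1)\<bar> * indicator (cball 0 (R + h)) (x + t *\<^sub>R axis i 1) \<partial>lborel)"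
    proof (intro nn_integral_mono mult_left_mono)
      fix x
      have "x + t *\<^sub>R axis i 1 \<in> cball 0 (R + h)" if "x \<in> K"
        using that R norm_triangle_ineq[of x "t *\<^sub>R axis i 1"] \<open>0 \<le> t\<close> \<open>t \<le> h\<close> by fastforce
      then show "indicator K x \<le> (indicator (cball 0 (R + h)) (x + t *\<^sub>R axis i 1) :: ennreal)"
        by (auto simp: indicator_def)
    qed simp
    also have "\<dots> = ?I"
      by (rule nn_integral_translate[where f="\<lambda>x. ennreal \<bar>f x\<bar> * indicator (cball 0 (R + h)) x"]) measurable
    finally show ?thesis .
  qed
  moreover have "?I < \<infinity>"
    using assms(1) by (auto simp: loc_L1_def)
  ultimately show ?thesis
    using that[of "enn2real ?I"] by simp
qed

lemma loc_L1_measurable: "loc_L1 f \<Longrightarrow> f \<in> borel_measurable borel"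
  by (simp add: loc_L1_def)

lemma loc_L1_diff:
  assumes "loc_L1 f" "loc_L1 g"
  shows "loc_L1 (\<lambda>x. f x - g x)"
  unfolding loc_L1_def
proof (intro conjI allI impI)
  note [measurable] = assms[THEN loc_L1_measurable]
  show "(\<lambda>x. f x - g x) \<in> borel_measurable lborel" by measurable
  fix K :: "(real^2) set" assume K: "compact K"
  then have [measurable]: "K \<in> sets borel" by (simp add: borel_compact)
  have "(\<integral>\<^sup>+x\<in>K. ennreal \<bar>f x - g x\<bar> \<partial>lborel)
      \<le> (\<integral>\<^sup>+x. ennreal \<bar>f x\<bar> * indicator K x + ennreal \<bar>g x\<bar> * indicator K x \<partial>lborel)"
    by (intro nn_integral_mono)
      (auto simp: indicator_def simp flip: ennreal_plus intro!: ennreal_leI)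
  also have "\<dots> = (\<integral>\<^sup>+x\<in>K. ennreal \<bar>f x\<bar> \<partial>lborel) + (\<integral>\<^sup>+x\<in>K. ennreal \<bar>g x\<bar> \<partial>lborel)"
    by (intro nn_integral_add) measurable
  also have "\<dots> < \<infinity>"
    using assms K by (auto simp: loc_L1_def)
  finally show "(\<integral>\<^sup>+x\<in>K. ennreal \<bar>f x - g x\<bar> \<partial>lborel) < \<infinity>" .
qed

lemma loc_L1_translate:
  assumes f: "loc_L1 f" and "h \<ge> 0"
  shows "loc_L1 (\<lambda>x. f (x + h *\<^sub>R axis i 1))"
  unfolding loc_L1_def
proof (intro conjI allI impI)
  note [measurable] = f[THEN loc_L1_measurable]
  show "(\<lambda>x. f (x + h *\<^sub>R axis i 1)) \<in> borel_measurable lborel" by measurable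
  fix K :: "(real^2) set" assume "compact K"
  then obtain C where "\<And>t. 0 \<le> t \<Longrightarrow> t \<le> h \<Longrightarrow>
    (\<integral>\<^sup>+x. ennreal \<bar>f (x + t *\<^sub>R axis i 1)\<bar> * indicator K x \<partial>lborel) \<le> ennreal C"
    using loc_L1_translate_bound[OF f compact_imp_bounded] by blast
  from this[of h] assms(2)
  show "(\<integral>\<^sup>+x\<in>K. ennreal \<bar>f (x + h *\<^sub>R axis i 1)\<bar> \<partial>lborel) < \<infinity>"
    by (auto intro: le_less_trans)
qed

text \<open>These are the hypotheses of Fubini before and after a change of variables: the shift
  sits on \<open>f\<close> in the first version and on \<open>\<phi>\<close> in the second, which
  follows from the first by translation.\<close>

lemma integrable_pair_strip_bounded:
  assumes f: "loc_L1 f" and "bounded K" and [measurable]: "\<phi> \<in> borel_measurable borel"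
    and bound: "\<And>x. \<bar>\<phi> x\<bar> \<le> B" and supp: "\<And>x. x \<notin> K \<Longrightarrow> \<phi> x = 0"
  shows "integrable (lborel \<Otimes>\<^sub>M lborel) (\<lambda>(x, t). indicator {0..h} t * (f (x + t *\<^sub>R axis i 1) * \<phi> x))"
    and "integrable (lborel \<Otimes>\<^sub>M lborel) (\<lambda>(x, t). indicator {0..h} t * (f x * \<phi> (x - t *\<^sub>R axis i 1)))"
proof -
  note [measurable] = f[THEN loc_L1_measurable]
  obtain C where C: "\<And>t. 0 \<le> t \<Longrightarrow> t \<le> h \<Longrightarrow>
    (\<integral>\<^sup>+x. ennreal \<bar>f (x + t *\<^sub>R axis i 1)\<bar> * indicator (closure K) x \<partial>lborel) \<le> ennreal C"
    using loc_L1_translate_bound[OF f bounded_closure[OF assms(2)]] by blast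
  have B: "B \<ge> 0" using bound[of 0] by linarith
  have le: "(\<integral>\<^sup>+x. ennreal \<bar>f (x + t *\<^sub>R axis i 1) * \<phi> x\<bar> \<partial>lborel) \<le> ennreal (B * C)"
    if "0 \<le> t" "t \<le> h" for t
  proof -
    have "(\<integral>\<^sup>+x. ennreal \<bar>f (x + t *\<^sub>R axis i 1) * \<phi> x\<bar> \<partial>lborel)
        \<le> (\<integral>\<^sup>+x. ennreal B * (ennreal \<bar>f (x + t *\<^sub>R axis i 1)\<bar> * indicator (closure K) x) \<partial>lborel)"
    proof (intro nn_integral_mono)
      fix x
      show "ennreal \<bar>f (x + t *\<^sub>R axis i 1) * \<phi> x\<bar>
          \<le> ennreal B * (ennreal \<bar>f (x + t *\<^sub>R axis i 1)\<bar> * indicator (closure K) x)"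
        using mult_right_mono[OF bound[of x], of "\<bar>f (x + t *\<^sub>R axis i 1)\<bar>"] B supp[of x] closure_subset[of K]
        by (cases "x \<in> K")
          (auto simp: abs_mult indicator_def mult.commute intro!: ennreal_leI simp flip: ennreal_mult)
    qed
    also have "\<dots> = ennreal B * (\<integral>\<^sup>+x. ennreal \<bar>f (x + t *\<^sub>R axis i 1)\<bar> * indicator (closure K) x \<partial>lborel)"
      by (intro nn_integral_cmult) measurable
    also have "\<dots> \<le> ennreal B * ennreal C"
      by (intro mult_left_mono C that) simp
    finally show ?thesis using B by (simp add: ennreal_mult')
  qed
  then show "integrable (lborel \<Otimes>\<^sub>M lborel) (\<lambda>(x, t). indicator {0..h} t * (f (x + t *\<^sub>R axis i 1) * \<phi> x))"
    by (intro integrable_pair_strip) auto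
  have "(\<integral>\<^sup>+x. ennreal \<bar>f x * \<phi> (x - t *\<^sub>R axis i 1)\<bar> \<partial>lborel)
      = (\<integral>\<^sup>+x. ennreal \<bar>f (x + t *\<^sub>R axis i 1) * \<phi> x\<bar> \<partial>lborel)" for t
    using nn_integral_translate[of "\<lambda>x. ennreal \<bar>f x * \<phi> (x - t *\<^sub>R axis i 1)\<bar>" "t *\<^sub>R axis i 1"] by simp
  with le show "integrable (lborel \<Otimes>\<^sub>M lborel) (\<lambda>(x, t). indicator {0..h} t * (f x * \<phi> (x - t *\<^sub>R axis i 1)))"
    by (intro integrable_pair_strip) auto
qed

text \<open>With the indicator of a compact set as \<open>\<phi>\<close>, Fubini makes the line
  integral integrable over that set.\<close>

lemma loc_L1_strip_integral:
  assumes f: "loc_L1 f"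
  shows "loc_L1 (\<lambda>x. \<integral>t. indicator {0..h} t * f (x + t *\<^sub>R axis i 1) \<partial>lborel)"
  unfolding loc_L1_def
proof (intro conjI allI impI)
  note [measurable] = f[THEN loc_L1_measurable]
  show "(\<lambda>x. \<integral>t. indicator {0..h} t * f (x + t *\<^sub>R axis i 1) \<partial>lborel) \<in> borel_measurable lborel"
    by measurable
  fix K :: "(real^2) set" assume "compact K"
  then have [measurable]: "K \<in> sets borel" and "bounded K"
    by (auto simp: borel_compact compact_imp_bounded)
  then have "integrable (lborel \<Otimes>\<^sub>M lborel)
      (\<lambda>(x, t). indicator {0..h} t * (f (x + t *\<^sub>R axis i 1) * indicator K x))"
    by (intro integrable_pair_strip_bounded[where B=1 and K=K, OF f])
      (auto split: split_indicator)
  from lborel_pair.integrable_fst[OF this]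
  have "integrable lborel (\<lambda>x. (\<integral>t. indicator {0..h} t * f (x + t *\<^sub>R axis i 1) \<partial>lborel) * indicator K x)"
    by (simp add: mult.assoc[symmetric])
  then show "(\<integral>\<^sup>+x\<in>K. ennreal \<bar>\<integral>t. indicator {0..h} t * f (x + t *\<^sub>R axis i 1) \<partial>lborel\<bar> \<partial>lborel) < \<infinity>"
    by (simp add: integrable_iff_bounded abs_mult ennreal_mult ennreal_indicator flip: ennreal_indicator)
qed

text \<open>The translation moves from \<open>u\<close> to the bump, whose increment is the integral
  of its derivative along the line. After Fubini, the weak derivative is tested against each
  translated bump; translating back and exchanging the integrals again gives the right-hand
  side.\<close>

lemma weak_partial_translate_bump:
  assumes w: "weak_partial i u d" and "h \<ge> 0" and "k > 0"
  shows "(\<integral>x. (u (x + h *\<^sub>R axis i 1) - u x) * bump k a b x \<partial>lborel)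
    = (\<integral>x. (\<integral>t. indicator {0..h} t * d (x + t *\<^sub>R axis i 1) \<partial>lborel) * bump k a b x \<partial>lborel)"
proof -
  have u: "loc_L1 u" and d: "loc_L1 d"
    using w by (auto simp: weak_partial_def)
  note [measurable] = u[THEN loc_L1_measurable] d[THEN loc_L1_measurable]
  let ?e = "axis i 1 :: real^2"
  let ?\<phi> = "bump k a b" and ?\<psi> = "\<lambda>x. - dpart [i] (bump k a b) x"
  have int_u: "integrable lborel (\<lambda>x. u x * ?\<phi> (x - t *\<^sub>R ?e))" for t
    using loc_L1_integrable_bump[OF u \<open>k > 0\<close>] by (simp add: bump_translate)
  have weak: "(\<integral>x. u x * ?\<psi> (x - t *\<^sub>R ?e) \<partial>lborel) = (\<integral>x. d x * ?\<phi> (x - t *\<^sub>R ?e) \<partial>lborel)" for t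
  proof -
    have "(\<integral>x. u x * dpart [i] (bump k (a + t *\<^sub>R ?e) (b + t *\<^sub>R ?e)) x \<partial>lborel)
        = - (\<integral>x. d x * bump k (a + t *\<^sub>R ?e) (b + t *\<^sub>R ?e) x \<partial>lborel)"
      using w test_fun_bump[OF \<open>k > 0\<close>] unfolding weak_partial_def by blast
    then show ?thesis
      by (simp only: dpart_bump_translate bump_translate mult_minus_right integral_minus minus_minus)
  qed
  have shift: "(\<integral>x. f x * ?\<phi> (x - t *\<^sub>R ?e) \<partial>lborel) = (\<integral>x. f (x + t *\<^sub>R ?e) * ?\<phi> x \<partial>lborel)"
    if [measurable]: "f \<in> borel_measurable borel" for t f
    using integral_translate[of "\<lambda>x. f x * ?\<phi> (x - t *\<^sub>R ?e)" "t *\<^sub>R ?e"] by simp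
  obtain C where C: "\<And>x. \<bar>dpart [i] (bump k a b) x\<bar> \<le> C"
    using dpart_bump_bounded[OF \<open>k > 0\<close>] by blast
  have "(\<integral>x. (u (x + h *\<^sub>R ?e) - u x) * ?\<phi> x \<partial>lborel)
      = (\<integral>x. u (x + h *\<^sub>R ?e) * ?\<phi> x \<partial>lborel) - (\<integral>x. u x * ?\<phi> x \<partial>lborel)"
    using loc_L1_integrable_bump[OF loc_L1_translate[OF u \<open>h \<ge> 0\<close>] \<open>k > 0\<close>]
      loc_L1_integrable_bump[OF u \<open>k > 0\<close>]
    by (simp add: left_diff_distrib)
  also have "\<dots> = (\<integral>x. u x * (?\<phi> (x - h *\<^sub>R ?e) - ?\<phi> x) \<partial>lborel)"
    using int_u[of h] loc_L1_integrable_bump[OF u \<open>k > 0\<close>]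
    by (simp add: right_diff_distrib shift)
  also have "\<dots> = (\<integral>x. (\<integral>t. indicator {0..h} t * (u x * ?\<psi> (x - t *\<^sub>R ?e)) \<partial>lborel) \<partial>lborel)"
    unfolding bump_FTC[OF \<open>h \<ge> 0\<close>]
    by (intro Bochner_Integration.integral_cong refl) (simp add: mult.left_commute flip: integral_mult_right_zero)
  also have "\<dots> = (\<integral>t. (\<integral>x. indicator {0..h} t * (u x * ?\<psi> (x - t *\<^sub>R ?e)) \<partial>lborel) \<partial>lborel)"
    by (intro lborel_pair.Fubini_integral[symmetric]
        integrable_pair_strip_bounded(2)[where B=C and K="cbox a b", OF u])
      (use C dpart_bump_support[OF \<open>k > 0\<close>] in \<open>auto simp del: dpart.simps\<close>)
  also have "\<dots> = (\<integral>t. (\<integral>x. indicator {0..h} t * (d (x + t *\<^sub>R ?e) * ?\<phi> x) \<partial>lborel) \<partial>lborel)"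
    by (simp only: integral_mult_right_zero weak shift[of d] loc_L1_measurable[OF d])
  also have "\<dots> = (\<integral>x. (\<integral>t. indicator {0..h} t * (d (x + t *\<^sub>R ?e) * ?\<phi> x) \<partial>lborel) \<partial>lborel)"
    by (intro lborel_pair.Fubini_integral
        integrable_pair_strip_bounded(1)[where B=1 and K="box a b", OF d])
      (use bump_bounds bump_support[OF \<open>k > 0\<close>] in auto)
  finally show ?thesis
    by (simp add: mult.assoc[symmetric])
qed

text \<open>Both sides are locally integrable and have the same integral against every bump. The
  exceptional null set may depend on \<open>h\<close>; the later arguments fix one \<open>h\<close>
  at a time.\<close>

lemma weak_partial_translate:
  assumes w: "weak_partial i u d" and "h \<ge> 0"
  shows "AE x in lborel. u (x + h *\<^sub>R axis i 1) - u x
    = (\<integral>t. indicator {0..h} t * d (x + t *\<^sub>R axis i 1) \<partial>lborel)"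
proof -
  have u: "loc_L1 u" and d: "loc_L1 d"
    using w by (auto simp: weak_partial_def)
  have loc: "loc_L1 (\<lambda>x. u (x + h *\<^sub>R axis i 1) - u x)"
    "loc_L1 (\<lambda>x. \<integral>t. indicator {0..h} t * d (x + t *\<^sub>R axis i 1) \<partial>lborel)"
    by (intro loc_L1_diff loc_L1_translate u \<open>h \<ge> 0\<close> loc_L1_strip_integral d)+
  have "AE x in lborel. u (x + h *\<^sub>R axis i 1) - u x
      - (\<integral>t. indicator {0..h} t * d (x + t *\<^sub>R axis i 1) \<partial>lborel) = 0"
    using weak_partial_translate_bump[OF w \<open>h \<ge> 0\<close>]
    by (intro fundamental_lemma_bump loc_L1_diff[OF loc])
      (simp add: left_diff_distrib[of "_ - _"] loc[THEN loc_L1_integrable_bump])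
  then show ?thesis by eventually_elim simp
qed

text \<open>Integrability is not assumed: the Bochner integral of a non-integrable function is 0 by
  convention.\<close>

lemma ennreal_abs_integral_le:
  fixes f :: "'a \<Rightarrow> real"
  shows "ennreal \<bar>\<integral>x. f x \<partial>M\<bar> \<le> (\<integral>\<^sup>+x. ennreal \<bar>f x\<bar> \<partial>M)"
  using integral_norm_bound_ennreal[of M f]
  by (cases "integrable M f") (auto simp: not_integrable_integral_eq)

lemma abs_le_1_plus_power2: "\<bar>y\<bar> \<le> 1 + y\<^sup>2" for y :: real
proof -
  have "0 \<le> (\<bar>y\<bar> - 1)\<^sup>2" by simp
  then have "2 * \<bar>y\<bar> \<le> 1 + y\<^sup>2" by (simp add: power2_diff)
  then show ?thesis using abs_ge_zero[of y] by linarith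
qed

section \<open>Orthogonality of a sphere-valued map and its gradient\<close>

text \<open>One factor \<open>h\<close> comes from Cauchy-Schwarz on the segment. The other comes
  from integrating over \<open>t\<close> after Tonelli, since translation invariance makes the inner
  integral independent of \<open>t\<close>.\<close>

lemma nn_integral_translate_diff_le:
  assumes w: "weak_partial i u d" and "h \<ge> 0"
  shows "(\<integral>\<^sup>+x. ennreal ((u (x + h *\<^sub>R axis i 1) - u x)\<^sup>2) \<partial>lborel)
    \<le> ennreal (h\<^sup>2) * (\<integral>\<^sup>+x. ennreal ((d x)\<^sup>2) \<partial>lborel)"
proof -
  have [measurable]: "d \<in> borel_measurable borel"
    using w by (auto simp: weak_partial_def loc_L1_def)
  let ?e = "axis i 1 :: real^2"
  have "AE x in lborel. ennreal ((u (x + h *\<^sub>R ?e) - u x)\<^sup>2)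
      \<le> ennreal h * (\<integral>\<^sup>+t. indicator {0..h} t * ennreal ((d (x + t *\<^sub>R ?e))\<^sup>2) \<partial>lborel)"
    using weak_partial_translate[OF assms]
  proof eventually_elim
    case (elim x)
    have "ennreal ((u (x + h *\<^sub>R ?e) - u x)\<^sup>2) = (ennreal \<bar>u (x + h *\<^sub>R ?e) - u x\<bar>)\<^sup>2"
      by (simp add: ennreal_power)
    also have "\<dots> \<le> (\<integral>\<^sup>+t. ennreal \<bar>indicator {0..h} t * d (x + t *\<^sub>R ?e)\<bar> \<partial>lborel)\<^sup>2"
      unfolding elim by (intro power_mono ennreal_abs_integral_le) simp
    \<comment> \<open>The indicator is doubled: one copy becomes a separate Cauchy-Schwarz factor of
      squared norm \<open>h\<close>, the other keeps the integrand on the segment.\<close>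
    also have "\<dots> = (\<integral>\<^sup>+t. indicator {0..h} t * (indicator {0..h} t * ennreal \<bar>d (x + t *\<^sub>R ?e)\<bar>) \<partial>lborel)\<^sup>2"
      by (intro arg_cong[where f="\<lambda>y. y\<^sup>2"] nn_integral_cong) (simp split: split_indicator)
    also have "\<dots> \<le> (\<integral>\<^sup>+t. (indicator {0..h} t)\<^sup>2 \<partial>lborel)
        * (\<integral>\<^sup>+t. (indicator {0..h} t * ennreal \<bar>d (x + t *\<^sub>R ?e)\<bar>)\<^sup>2 \<partial>lborel)"
      by (intro Cauchy_Schwarz_nn_integral) measurable
    also have "(\<integral>\<^sup>+t. (indicator {0..h} t)\<^sup>2 \<partial>lborel) = (\<integral>\<^sup>+t. indicator {0..h} t \<partial>lborel)"
      by (intro nn_integral_cong) (simp split: split_indicator)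
    also have "\<dots> = ennreal h"
      using \<open>h \<ge> 0\<close> by simp
    also have "(\<integral>\<^sup>+t. (indicator {0..h} t * ennreal \<bar>d (x + t *\<^sub>R ?e)\<bar>)\<^sup>2 \<partial>lborel)
        = (\<integral>\<^sup>+t. indicator {0..h} t * ennreal ((d (x + t *\<^sub>R ?e))\<^sup>2) \<partial>lborel)"
      by (intro nn_integral_cong) (simp add: ennreal_power split: split_indicator)
    finally show ?case .
  qed
  then have "(\<integral>\<^sup>+x. ennreal ((u (x + h *\<^sub>R ?e) - u x)\<^sup>2) \<partial>lborel)
      \<le> (\<integral>\<^sup>+x. ennreal h * (\<integral>\<^sup>+t. indicator {0..h} t * ennreal ((d (x + t *\<^sub>R ?e))\<^sup>2) \<partial>lborel) \<partial>lborel)"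
    by (rule nn_integral_mono_AE)
  also have "\<dots> = ennreal h * (\<integral>\<^sup>+x. (\<integral>\<^sup>+t. indicator {0..h} t * ennreal ((d (x + t *\<^sub>R ?e))\<^sup>2) \<partial>lborel) \<partial>lborel)"
    by (intro nn_integral_cmult) measurable
  also have "(\<integral>\<^sup>+x. (\<integral>\<^sup>+t. indicator {0..h} t * ennreal ((d (x + t *\<^sub>R ?e))\<^sup>2) \<partial>lborel) \<partial>lborel)
      = (\<integral>\<^sup>+t. (\<integral>\<^sup>+x. indicator {0..h} t * ennreal ((d (x + t *\<^sub>R ?e))\<^sup>2) \<partial>lborel) \<partial>lborel)"
    by (intro lborel_pair.Fubini'[symmetric]) measurable
  also have "\<dots> = (\<integral>\<^sup>+t. indicator {0..h} t * (\<integral>\<^sup>+x. ennreal ((d x)\<^sup>2) \<partial>lborel) \<partial>lborel)"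
    by (simp add: nn_integral_cmult nn_integral_translate[of "\<lambda>x. ennreal ((d x)\<^sup>2)"])
  also have "\<dots> = ennreal h * (\<integral>\<^sup>+x. ennreal ((d x)\<^sup>2) \<partial>lborel)"
    using \<open>h \<ge> 0\<close> by (subst nn_integral_multc) auto
  finally show ?thesis
    using \<open>h \<ge> 0\<close> by (simp add: power2_eq_square ennreal_mult mult.assoc)
qed

lemma integral_translate_diff_le:
  assumes w: "weak_partial i u d" and "h \<ge> 0" and d: "integrable lborel (\<lambda>x. (d x)\<^sup>2)"
  shows "integrable lborel (\<lambda>x. (u (x + h *\<^sub>R axis i 1) - u x)\<^sup>2)"
    and "(\<integral>x. (u (x + h *\<^sub>R axis i 1) - u x)\<^sup>2 \<partial>lborel) \<le> h\<^sup>2 * (\<integral>x. (d x)\<^sup>2 \<partial>lborel)"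
proof -
  have [measurable]: "u \<in> borel_measurable borel"
    using w by (auto simp: weak_partial_def loc_L1_def)
  have "(\<integral>\<^sup>+x. ennreal ((d x)\<^sup>2) \<partial>lborel) = ennreal (\<integral>x. (d x)\<^sup>2 \<partial>lborel)"
    by (rule nn_integral_eq_integral[OF d]) simp
  with nn_integral_translate_diff_le[OF assms(1,2)]
  have le: "(\<integral>\<^sup>+x. ennreal ((u (x + h *\<^sub>R axis i 1) - u x)\<^sup>2) \<partial>lborel)
      \<le> ennreal (h\<^sup>2 * (\<integral>x. (d x)\<^sup>2 \<partial>lborel))"
    by (simp add: ennreal_mult)
  show int: "integrable lborel (\<lambda>x. (u (x + h *\<^sub>R axis i 1) - u x)\<^sup>2)"
    by (rule integrableI_nonneg) (use le in \<open>auto intro: le_less_trans\<close>)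
  show "(\<integral>x. (u (x + h *\<^sub>R axis i 1) - u x)\<^sup>2 \<partial>lborel) \<le> h\<^sup>2 * (\<integral>x. (d x)\<^sup>2 \<partial>lborel)"
    using le by (subst (asm) nn_integral_eq_integral[OF int]) auto
qed

text \<open>Translating the product \<open>bump k a b x * u x\<close> costs a change of the bump,
  which is Lipschitz, and a change of \<open>u\<close>, whose squared norm is of order
  \<open>t\<^sup>2\<close>. Paired with the square-integrable \<open>d\<close>, both changes are of
  order \<open>t\<close>.\<close>

lemma bump_strip_integral_Lipschitz:
  assumes w: "weak_partial i u d" and d: "integrable lborel (\<lambda>x. (d x)\<^sup>2)"
    and u1: "\<And>x. \<bar>u x\<bar> \<le> 1" and "k > 0"
  obtains C where "\<And>t. 0 \<le> t \<Longrightarrow> t \<le> 1 \<Longrightarrow>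
    \<bar>(\<integral>x. d x * (bump k a b (x - t *\<^sub>R axis i 1) * u (x - t *\<^sub>R axis i 1)) \<partial>lborel)
      - (\<integral>x. d x * (bump k a b x * u x) \<partial>lborel)\<bar> \<le> C * t"
proof -
  have u: "loc_L1 u" and dl: "loc_L1 d"
    using w by (auto simp: weak_partial_def)
  note [measurable] = u[THEN loc_L1_measurable] dl[THEN loc_L1_measurable]
  let ?e = "axis i 1 :: real^2" and ?\<phi> = "bump k a b"
  let ?P = "\<integral>x. (d x)\<^sup>2 \<partial>lborel"
  obtain L where L: "L \<ge> 0" "\<And>x. \<bar>dpart [i] ?\<phi> x\<bar> \<le> L"
    using dpart_bump_bounded[OF \<open>k > 0\<close>] by blast
  obtain R where R: "\<And>x. x \<in> box a b \<Longrightarrow> norm x \<le> R"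
    using bounded_box bounded_iff by metis
  \<comment> \<open>The radius \<open>R + 1\<close> suffices for all \<open>t \<le> 1\<close>:
    outside this ball both \<open>x\<close> and its shift miss the box.\<close>
  let ?K = "cball 0 (R + 1) :: (real^2) set"
  have [measurable]: "?K \<in> sets borel" by simp
  have intK: "integrable lborel (indicator ?K :: real^2 \<Rightarrow> real)"
    using emeasure_bounded_finite[OF bounded_cball, of "0 :: real^2" "R + 1"]
    by (intro integrable_real_indicator) auto
  have int: "integrable lborel (\<lambda>x. d x * (?\<phi> (x - t *\<^sub>R ?e) * u (x - t *\<^sub>R ?e)))" for t
  proof (rule loc_L1_integrable_mult[OF dl, where C=1 and K="box (a + t *\<^sub>R ?e) (b + t *\<^sub>R ?e)"])
    show "\<bar>?\<phi> (x - t *\<^sub>R ?e) * u (x - t *\<^sub>R ?e)\<bar> \<le> 1" for x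
      using bump_bounds[of k a b "x - t *\<^sub>R ?e"] u1[of "x - t *\<^sub>R ?e"]
      by (simp add: abs_mult mult_le_one)
  qed (auto simp: bump_translate bump_support[OF \<open>k > 0\<close>])
  have "\<bar>(\<integral>x. d x * (?\<phi> (x - t *\<^sub>R ?e) * u (x - t *\<^sub>R ?e)) \<partial>lborel)
      - (\<integral>x. d x * (?\<phi> x * u x) \<partial>lborel)\<bar> \<le> (L * (measure lborel ?K + ?P) + ?P) * t"
    if t: "0 \<le> t" "t \<le> 1" for t
  proof (cases "t = 0")
    case False
    then have "t > 0" using t by simp
    let ?\<Delta> = "\<lambda>x. (u x - u (x - t *\<^sub>R ?e))\<^sup>2"
    \<comment> \<open>The first summand dominates the change of the bump, the second the change of
      \<open>u\<close>. The integral of \<open>?\<Delta>\<close> is at most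
      \<open>t\<^sup>2 * ?P\<close>, so division by \<open>2 * t\<close> leaves order
      \<open>t\<close>.\<close>
    let ?W = "\<lambda>x. t * L * (indicator ?K x + (d x)\<^sup>2) + (t / 2 * (d x)\<^sup>2 + ?\<Delta> x / (2 * t))"
    have "integrable lborel ?\<Delta>"
    proof (rule integrableI_nonneg)
      have "(\<integral>\<^sup>+x. ennreal (?\<Delta> x) \<partial>lborel) = (\<integral>\<^sup>+x. ennreal ((u (x + t *\<^sub>R ?e) - u x)\<^sup>2) \<partial>lborel)"
        using nn_integral_translate[of "\<lambda>x. ennreal (?\<Delta> x)" "t *\<^sub>R ?e"] by simp
      then show "(\<integral>\<^sup>+x. ennreal (?\<Delta> x) \<partial>lborel) < \<infinity>"
        using integral_translate_diff_le(1)[OF w t(1) d] by (simp add: integrable_iff_bounded)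
    qed auto
    moreover have "(\<integral>x. ?\<Delta> x \<partial>lborel) \<le> t\<^sup>2 * ?P"
      using integral_translate_diff_le(2)[OF w t(1) d] integral_translate[of ?\<Delta> "t *\<^sub>R ?e"] by simp
    ultimately have intW: "integrable lborel ?W"
      and W0: "(\<integral>x. ?W x \<partial>lborel) \<le> t * L * (measure lborel ?K + ?P) + (t / 2 * ?P + t\<^sup>2 * ?P / (2 * t))"
      using intK d \<open>t > 0\<close> by (auto simp: divide_right_mono)
    note W0
    also have "t * L * (measure lborel ?K + ?P) + (t / 2 * ?P + t\<^sup>2 * ?P / (2 * t))
        = (L * (measure lborel ?K + ?P) + ?P) * t"
      using \<open>t > 0\<close> by (simp add: field_simps power2_eq_square)
    finally have W: "(\<integral>x. ?W x \<partial>lborel) \<le> (L * (measure lborel ?K + ?P) + ?P) * t" .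
    have bound: "\<bar>d x * (?\<phi> (x - t *\<^sub>R ?e) * u (x - t *\<^sub>R ?e)) - d x * (?\<phi> x * u x)\<bar> \<le> ?W x" for x
    proof -
      have 1: "\<bar>d x\<bar> * \<bar>?\<phi> (x - t *\<^sub>R ?e) - ?\<phi> x\<bar> \<le> t * L * (indicator ?K x + (d x)\<^sup>2)"
      proof (cases "x \<in> ?K")
        case True
        have "\<bar>d x\<bar> \<le> 1 + (d x)\<^sup>2"
          by (rule abs_le_1_plus_power2)
        then have "\<bar>d x\<bar> * \<bar>?\<phi> (x - t *\<^sub>R ?e) - ?\<phi> x\<bar> \<le> (1 + (d x)\<^sup>2) * (t * L)"
          using bump_Lipschitz[OF t(1) L(2), of x] by (intro mult_mono) auto
        then show ?thesis using True by (simp add: mult.commute)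
      next
        case False
        have "x \<notin> box a b" "x - t *\<^sub>R ?e \<notin> box a b"
          using False R[of x] R[of "x - t *\<^sub>R ?e"] t norm_triangle_ineq2[of x "t *\<^sub>R ?e"] by auto
        then show ?thesis
          using t L(1) by (simp add: bump_support[OF \<open>k > 0\<close>])
      qed
      \<comment> \<open>Young's inequality with weight \<open>t\<close>, which gives both resulting
        terms an integral of order \<open>t\<close>.\<close>
      have "0 \<le> (t * \<bar>d x\<bar> - \<bar>u x - u (x - t *\<^sub>R ?e)\<bar>)\<^sup>2 / (2 * t)"
        using \<open>t > 0\<close> by simp
      also have "\<dots> = t / 2 * (d x)\<^sup>2 + ?\<Delta> x / (2 * t) - \<bar>d x\<bar> * \<bar>u x - u (x - t *\<^sub>R ?e)\<bar>"
        using \<open>t > 0\<close> by (simp add: power2_diff power_mult_distrib field_simps) (simp add: power2_eq_square)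
      finally have 2: "\<bar>d x\<bar> * \<bar>u x - u (x - t *\<^sub>R ?e)\<bar> \<le> t / 2 * (d x)\<^sup>2 + ?\<Delta> x / (2 * t)"
        by simp
      have "d x * (?\<phi> (x - t *\<^sub>R ?e) * u (x - t *\<^sub>R ?e)) - d x * (?\<phi> x * u x)
          = d x * (?\<phi> (x - t *\<^sub>R ?e) - ?\<phi> x) * u (x - t *\<^sub>R ?e) - d x * (u x - u (x - t *\<^sub>R ?e)) * ?\<phi> x"
        by (simp add: algebra_simps)
      also have "\<bar>\<dots>\<bar> \<le> \<bar>d x * (?\<phi> (x - t *\<^sub>R ?e) - ?\<phi> x)\<bar> * 1 + \<bar>d x * (u x - u (x - t *\<^sub>R ?e))\<bar> * 1"
        using u1 bump_bounds[of k a b x]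
        by (intro order_trans[OF abs_triangle_ineq4] add_mono) (auto simp: abs_mult intro!: mult_left_le)
      also have "\<dots> \<le> ?W x"
        using 1 2 by (simp add: abs_mult)
      finally show ?thesis .
    qed
    have eq: "(\<integral>x. d x * (?\<phi> (x - t *\<^sub>R ?e) * u (x - t *\<^sub>R ?e)) \<partial>lborel) - (\<integral>x. d x * (?\<phi> x * u x) \<partial>lborel)
        = (\<integral>x. d x * (?\<phi> (x - t *\<^sub>R ?e) * u (x - t *\<^sub>R ?e)) - d x * (?\<phi> x * u x) \<partial>lborel)"
      using int[of t] int[of 0] by simp
    show ?thesis
      unfolding eq
    proof (rule order_trans[OF integral_abs_bound order_trans[OF integral_mono[OF _ intW bound] W]])
      show "integrable lborel (\<lambda>x. \<bar>d x * (?\<phi> (x - t *\<^sub>R ?e) * u (x - t *\<^sub>R ?e)) - d x * (?\<phi> x * u x)\<bar>)"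
        using int[of t] int[of 0] by (intro integrable_abs Bochner_Integration.integrable_diff) simp_all
    qed
  qed simp
  then show ?thesis by (rule that)
qed

lemma loc_L1_if_le:
  assumes [measurable]: "g \<in> borel_measurable borel" and f: "integrable lborel f"
    and le: "\<And>x. \<bar>g x\<bar> \<le> 1 + f x" and nonneg: "\<And>x. 0 \<le> f x"
  shows "loc_L1 g"
  unfolding loc_L1_def
proof (intro conjI allI impI)
  fix K :: "(real^2) set" assume K: "compact K"
  then have [measurable]: "K \<in> sets borel" by (simp add: borel_compact)
  have [measurable]: "f \<in> borel_measurable borel" using f by auto
  have "(\<integral>\<^sup>+x\<in>K. ennreal \<bar>g x\<bar> \<partial>lborel) \<le> (\<integral>\<^sup>+x. indicator K x + ennreal (f x) \<partial>lborel)"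
  proof (intro nn_integral_mono)
    fix x
    have "ennreal \<bar>g x\<bar> \<le> 1 + ennreal (f x)"
      using ennreal_leI[OF le[of x]] nonneg[of x] by simp
    then show "ennreal \<bar>g x\<bar> * indicator K x \<le> indicator K x + ennreal (f x)"
      by (simp split: split_indicator)
  qed
  also have "\<dots> = emeasure lborel K + (\<integral>\<^sup>+x. ennreal (f x) \<partial>lborel)"
    by (subst nn_integral_add) auto
  also have "\<dots> < \<infinity>"
    using emeasure_bounded_finite[OF compact_imp_bounded[OF K]] nn_integral_eq_integral[OF f] nonneg
    by simp
  finally show "(\<integral>\<^sup>+x\<in>K. ennreal \<bar>g x\<bar> \<partial>lborel) < \<infinity>" .
qed simp

text \<open>The chain rule for \<open>u\<^sup>2\<close> in integrated form; summed over the components of a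
  sphere-valued map, the squares cancel and only \<open>2 h \<integral>(n \<bullet> \<partial>\<^sub>i n) \<phi>\<close> is left.\<close>

lemma bump_square_difference:
  assumes w: "weak_partial i u d" and d: "integrable lborel (\<lambda>x. (d x)\<^sup>2)"
    and u1: "\<And>x. \<bar>u x\<bar> \<le> 1" and "k > 0"
  shows "\<exists>C. \<forall>h\<in>{0..1}.
    \<bar>(\<integral>x. ((u (x + h *\<^sub>R axis i 1))\<^sup>2 - (u x)\<^sup>2) * bump k a b x \<partial>lborel)
      - 2 * h * (\<integral>x. d x * (bump k a b x * u x) \<partial>lborel)\<bar> \<le> C * h\<^sup>2"
proof -
  have u: "loc_L1 u" and dl: "loc_L1 d"
    using w by (auto simp: weak_partial_def)
  note [measurable] = u[THEN loc_L1_measurable] dl[THEN loc_L1_measurable]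
  let ?e = "axis i 1 :: real^2" and ?\<phi> = "bump k a b"
  let ?P = "\<integral>x. (d x)\<^sup>2 \<partial>lborel"
  define Q where "Q t = (\<integral>x. d x * (?\<phi> (x - t *\<^sub>R ?e) * u (x - t *\<^sub>R ?e)) \<partial>lborel)" for t
  obtain C where C: "\<And>t. 0 \<le> t \<Longrightarrow> t \<le> 1 \<Longrightarrow> \<bar>Q t - Q 0\<bar> \<le> C * t"
    using bump_strip_integral_Lipschitz[OF assms] unfolding Q_def by auto
  have "C \<ge> 0" using C[of 1] by simp
  have \<phi>u: "\<bar>?\<phi> x * u x\<bar> \<le> 1" for x
    using bump_bounds[of k a b x] u1[of x] by (simp add: abs_mult mult_le_one)
  show ?thesis
  proof (intro exI ballI)
    fix h :: real assume "h \<in> {0..1}"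
    then have h: "0 \<le> h" "h \<le> 1" by auto
    let ?\<Delta> = "\<lambda>x. u (x + h *\<^sub>R ?e) - u x"
    have "(\<integral>x. ?\<Delta> x * (?\<phi> x * u x) \<partial>lborel)
        = (\<integral>x. (\<integral>t. indicator {0..h} t * (d (x + t *\<^sub>R ?e) * (?\<phi> x * u x)) \<partial>lborel) \<partial>lborel)"
    proof (rule integral_cong_AE)
      show "AE x in lborel. ?\<Delta> x * (?\<phi> x * u x)
          = (\<integral>t. indicator {0..h} t * (d (x + t *\<^sub>R ?e) * (?\<phi> x * u x)) \<partial>lborel)"
        using weak_partial_translate[OF w h(1)] by eventually_elim (simp add: mult.assoc[symmetric])
    qed measurable
    also have "\<dots> = (\<integral>t. (\<integral>x. indicator {0..h} t * (d (x + t *\<^sub>R ?e) * (?\<phi> x * u x)) \<partial>lborel) \<partial>lborel)"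
      by (intro lborel_pair.Fubini_integral[symmetric]
          integrable_pair_strip_bounded(1)[where B=1 and K="box a b", OF dl])
        (use \<phi>u bump_support[OF \<open>k > 0\<close>] in auto)
    also have "\<dots> = (\<integral>t. indicator {0..h} t * Q t \<partial>lborel)"
    proof -
      have "(\<integral>x. d (x + t *\<^sub>R ?e) * (?\<phi> x * u x) \<partial>lborel) = Q t" for t
        using integral_translate[of "\<lambda>x. d x * (?\<phi> (x - t *\<^sub>R ?e) * u (x - t *\<^sub>R ?e))" "t *\<^sub>R ?e"]
        by (simp add: Q_def)
      then show ?thesis by (simp only: integral_mult_right_zero)
    qed
    finally have first: "(\<integral>x. ?\<Delta> x * (?\<phi> x * u x) \<partial>lborel) = (\<integral>t. indicator {0..h} t * Q t \<partial>lborel)" .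
    have intQ: "integrable lborel (\<lambda>t. indicator {0..h} t * Q t)"
    proof -
      have "integrable (lborel \<Otimes>\<^sub>M lborel)
          (\<lambda>(x, t). indicator {0..h} t * (d x * (?\<phi> (x - t *\<^sub>R ?e) * u (x - t *\<^sub>R ?e))))"
        by (intro integrable_pair_strip_bounded(2)[where B=1 and K="box a b"
              and \<phi>="\<lambda>x. ?\<phi> x * u x", OF dl])
          (use \<phi>u bump_support[OF \<open>k > 0\<close>] in auto)
      from lborel_pair.integrable_snd[OF this] show ?thesis
        by (simp add: Q_def)
    qed
    have int0: "integrable lborel (\<lambda>t. indicator {0..h} t * Q 0)"
      using h(1) by (intro integrable_mult_left) auto
    \<comment> \<open>On \<open>{0..h}\<close> the function \<open>Q\<close> differs from
      \<open>Q 0\<close> by at most \<open>C * h\<close>. Integrated over a length \<open>h\<close>,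
      this is an error of second order.\<close>
    have "\<bar>(\<integral>x. ?\<Delta> x * (?\<phi> x * u x) \<partial>lborel) - h * Q 0\<bar>
        = \<bar>\<integral>t. indicator {0..h} t * Q t - indicator {0..h} t * Q 0 \<partial>lborel\<bar>"
      unfolding first using h(1) by (subst Bochner_Integration.integral_diff[OF intQ int0]) simp
    also have "\<dots> \<le> (\<integral>t. indicator {0..h} t * (C * h) \<partial>lborel)"
    proof (rule order_trans[OF integral_abs_bound integral_mono'])
      show "integrable lborel (\<lambda>t. indicator {0..h} t * (C * h))"
        using h(1) by (intro integrable_mult_left) auto
      show "0 \<le> indicator {0..h} t * (C * h)" for t :: real
        using h(1) \<open>C \<ge> 0\<close> by simp
      show "\<bar>indicator {0..h} t * Q t - indicator {0..h} t * Q 0\<bar> \<le> indicator {0..h} t * (C * h)" for t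
      proof (cases "t \<in> {0..h}")
        case True
        then have "\<bar>Q t - Q 0\<bar> \<le> C * t" using C h by simp
        also have "\<dots> \<le> C * h" using True \<open>C \<ge> 0\<close> by (intro mult_left_mono) auto
        finally show ?thesis using True by simp
      qed simp
    qed
    also have "\<dots> = C * h\<^sup>2" using h(1) by (simp add: power2_eq_square)
    finally have A: "\<bar>(\<integral>x. ?\<Delta> x * (?\<phi> x * u x) \<partial>lborel) - h * Q 0\<bar> \<le> C * h\<^sup>2" .
    note \<Delta>2 = integral_translate_diff_le[OF w h(1) d]
    have int2: "integrable lborel (\<lambda>x. (?\<Delta> x)\<^sup>2 * ?\<phi> x)"
      by (rule Bochner_Integration.integrable_bound[OF \<Delta>2(1)])
        (auto simp: abs_mult bump_bounds intro!: AE_I2 mult_left_le)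
    have "(\<integral>x. (?\<Delta> x)\<^sup>2 * ?\<phi> x \<partial>lborel) \<le> (\<integral>x. (?\<Delta> x)\<^sup>2 \<partial>lborel)"
      by (intro integral_mono int2 \<Delta>2(1) mult_left_le) (auto simp: bump_bounds)
    then have B: "0 \<le> (\<integral>x. (?\<Delta> x)\<^sup>2 * ?\<phi> x \<partial>lborel)" "(\<integral>x. (?\<Delta> x)\<^sup>2 * ?\<phi> x \<partial>lborel) \<le> h\<^sup>2 * ?P"
      using \<Delta>2(2) by (auto intro!: integral_nonneg_AE simp: bump_bounds)
    have int1: "integrable lborel (\<lambda>x. ?\<Delta> x * (?\<phi> x * u x))"
      by (rule loc_L1_integrable_mult[OF loc_L1_diff[OF loc_L1_translate[OF u h(1)] u], where C=1 and K="box a b"])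
        (use \<phi>u bump_support[OF \<open>k > 0\<close>] in auto)
    \<comment> \<open>The identity
      \<open>a\<^sup>2 - b\<^sup>2 = 2 * (a - b) * b + (a - b)\<^sup>2\<close> is used; the last
      square contributes at most \<open>h\<^sup>2 * ?P\<close>.\<close>
    have "(\<integral>x. ((u (x + h *\<^sub>R ?e))\<^sup>2 - (u x)\<^sup>2) * ?\<phi> x \<partial>lborel)
        = (\<integral>x. 2 * (?\<Delta> x * (?\<phi> x * u x)) + (?\<Delta> x)\<^sup>2 * ?\<phi> x \<partial>lborel)"
      by (intro Bochner_Integration.integral_cong refl) (simp add: power2_eq_square algebra_simps)
    also have "\<dots> = 2 * (\<integral>x. ?\<Delta> x * (?\<phi> x * u x) \<partial>lborel) + (\<integral>x. (?\<Delta> x)\<^sup>2 * ?\<phi> x \<partial>lborel)"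
      by (subst Bochner_Integration.integral_add[OF integrable_mult_right[OF int1] int2]) simp
    finally have eq: "(\<integral>x. ((u (x + h *\<^sub>R ?e))\<^sup>2 - (u x)\<^sup>2) * ?\<phi> x \<partial>lborel)
        = 2 * (\<integral>x. ?\<Delta> x * (?\<phi> x * u x) \<partial>lborel) + (\<integral>x. (?\<Delta> x)\<^sup>2 * ?\<phi> x \<partial>lborel)" .
    have "Q 0 = (\<integral>x. d x * (?\<phi> x * u x) \<partial>lborel)"
      by (simp add: Q_def)
    with A B eq show "\<bar>(\<integral>x. ((u (x + h *\<^sub>R ?e))\<^sup>2 - (u x)\<^sup>2) * ?\<phi> x \<partial>lborel)
        - 2 * h * (\<integral>x. d x * (?\<phi> x * u x) \<partial>lborel)\<bar> \<le> (2 * C + ?P) * h\<^sup>2"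
      by (simp add: algebra_simps abs_le_iff)
  qed
qed

text \<open>Summed over components, the differences of squares vanish because the norm is constantly
  1. What remains is a first-order term \<open>2 * h * \<bar>?S\<bar>\<close> bounded by a multiple
  of \<open>h\<^sup>2\<close> for all small \<open>h\<close>, so \<open>?S = 0\<close>. Since
  \<open>?S\<close> is the integral of \<open>n x \<bullet> d x\<close> against the bump, the
  fundamental lemma applies.\<close>

lemma sphere_map_orthogonal:
  fixes n d :: "real^2 \<Rightarrow> real^3"
  assumes sphere: "\<And>x. norm (n x) = 1"
    and w: "\<And>k. weak_partial i (\<lambda>x. n x $ k) (\<lambda>x. d x $ k)"
    and d: "\<And>k. integrable lborel (\<lambda>x. (d x $ k)\<^sup>2)"
  shows "AE x in lborel. n x \<bullet> d x = 0"
proof -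
  let ?e = "axis i 1 :: real^2"
  have nl: "loc_L1 (\<lambda>x. n x $ k)" and dl: "loc_L1 (\<lambda>x. d x $ k)" for k
    using w[of k] by (auto simp: weak_partial_def)
  note [measurable] = nl[THEN loc_L1_measurable] dl[THEN loc_L1_measurable]
  have n1: "\<bar>n x $ k\<bar> \<le> 1" for x k
    using component_le_norm_cart[of "n x" k] sphere by simp
  have inner: "n x \<bullet> d x = (\<Sum>k\<in>UNIV. d x $ k * n x $ k)" for x
    by (simp add: inner_vec_def mult.commute)
  have sq: "(\<Sum>k\<in>UNIV. (n x $ k)\<^sup>2) = 1" for x
    using sphere[of x] by (simp add: norm_vec_def L2_set_def)
  show ?thesis
  proof (rule fundamental_lemma_bump)
    show "loc_L1 (\<lambda>x. n x \<bullet> d x)"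
    proof (rule loc_L1_if_le)
      show "integrable lborel (\<lambda>x. \<Sum>k\<in>UNIV. (d x $ k)\<^sup>2)"
        using d by simp
      fix x
      have "\<bar>n x \<bullet> d x\<bar> \<le> norm (d x)"
        using Cauchy_Schwarz_ineq2[of "n x" "d x"] sphere by simp
      also have "\<dots> \<le> 1 + (norm (d x))\<^sup>2"
        using abs_le_1_plus_power2[of "norm (d x)"] by simp
      also have "(norm (d x))\<^sup>2 = (\<Sum>k\<in>UNIV. (d x $ k)\<^sup>2)"
        by (simp add: norm_vec_def L2_set_def sum_nonneg)
      finally show "\<bar>n x \<bullet> d x\<bar> \<le> 1 + (\<Sum>k\<in>UNIV. (d x $ k)\<^sup>2)" .
    qed (auto simp: inner sum_nonneg)
  next
    fix m :: real and a b assume "m > 0"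
    let ?\<phi> = "bump m a b"
    define S where "S k = (\<integral>x. d x $ k * (?\<phi> x * n x $ k) \<partial>lborel)" for k
    have "\<forall>k. \<exists>C. \<forall>h\<in>{0..1}.
      \<bar>(\<integral>x. ((n (x + h *\<^sub>R ?e) $ k)\<^sup>2 - (n x $ k)\<^sup>2) * ?\<phi> x \<partial>lborel) - 2 * h * S k\<bar> \<le> C * h\<^sup>2"
      unfolding S_def by (intro allI bump_square_difference w d n1 \<open>m > 0\<close>)
    from choice[OF this] obtain C where C: "\<And>k. \<forall>h\<in>{0..1}.
      \<bar>(\<integral>x. ((n (x + h *\<^sub>R ?e) $ k)\<^sup>2 - (n x $ k)\<^sup>2) * ?\<phi> x \<partial>lborel) - 2 * h * S k\<bar> \<le> C k * h\<^sup>2"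
      by blast
    let ?S = "\<Sum>k\<in>UNIV. S k" and ?C = "\<Sum>k\<in>UNIV. C k"
    have small: "2 * \<bar>?S\<bar> \<le> ?C * h" if h: "0 < h" "h \<le> 1" for h
    proof -
      have int: "integrable lborel (\<lambda>x. ((n (x + h *\<^sub>R ?e) $ k)\<^sup>2 - (n x $ k)\<^sup>2) * ?\<phi> x)" for k
      proof (intro loc_L1_integrable_bump[OF _ \<open>m > 0\<close>] loc_L1_if_le[where f="\<lambda>_. 0"])
        fix x
        have "(n (x + h *\<^sub>R ?e) $ k)\<^sup>2 \<le> 1" "(n x $ k)\<^sup>2 \<le> 1"
          using n1 by (simp_all add: abs_square_le_1)
        then show "\<bar>(n (x + h *\<^sub>R ?e) $ k)\<^sup>2 - (n x $ k)\<^sup>2\<bar> \<le> 1 + 0"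
          using zero_le_power2[of "n (x + h *\<^sub>R ?e) $ k"] zero_le_power2[of "n x $ k"]
          by linarith
      qed auto
      have "(\<Sum>k\<in>UNIV. \<integral>x. ((n (x + h *\<^sub>R ?e) $ k)\<^sup>2 - (n x $ k)\<^sup>2) * ?\<phi> x \<partial>lborel)
          = (\<integral>x. (\<Sum>k\<in>UNIV. ((n (x + h *\<^sub>R ?e) $ k)\<^sup>2 - (n x $ k)\<^sup>2) * ?\<phi> x) \<partial>lborel)"
        using int by simp
      also have "\<dots> = 0"
        by (simp add: sum_distrib_right[symmetric] sum_subtractf sq)
      finally have "2 * h * \<bar>?S\<bar>
          = \<bar>\<Sum>k\<in>UNIV. (\<integral>x. ((n (x + h *\<^sub>R ?e) $ k)\<^sup>2 - (n x $ k)\<^sup>2) * ?\<phi> x \<partial>lborel) - 2 * h * S k\<bar>"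
        using h by (simp add: sum_subtractf sum_distrib_left[symmetric] abs_mult)
      also have "\<dots> \<le> (\<Sum>k\<in>UNIV. C k * h\<^sup>2)"
        using C h by (intro order_trans[OF sum_abs] sum_mono) simp
      also have "\<dots> = h * (?C * h)"
        by (simp add: sum_distrib_right[symmetric] power2_eq_square)
      finally show ?thesis using h by simp
    qed
    have "?S = 0"
    proof (rule ccontr)
      assume "?S \<noteq> 0"
      \<comment> \<open>For this \<open>h\<close> the bound \<open>?C * h\<close> is at most
        \<open>\<bar>?S\<bar>\<close>, which contradicts
        \<open>2 * \<bar>?S\<bar> \<le> ?C * h\<close>. Adding 1 keeps the denominator
        positive.\<close>
      define h where "h = min 1 (\<bar>?S\<bar> / (\<bar>?C\<bar> + 1))"
      have h: "0 < h" "h \<le> 1" "h \<le> \<bar>?S\<bar> / (\<bar>?C\<bar> + 1)"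
        using \<open>?S \<noteq> 0\<close> by (auto simp: h_def)
      have "2 * \<bar>?S\<bar> \<le> ?C * h" by (rule small) (use h in auto)
      also have "\<dots> \<le> (\<bar>?C\<bar> + 1) * h" using h by (intro mult_right_mono) auto
      also have "\<dots> \<le> \<bar>?S\<bar>" using h(3) by (simp add: field_simps)
      finally show False using \<open>?S \<noteq> 0\<close> by simp
    qed
    have "(\<integral>x. n x \<bullet> d x * ?\<phi> x \<partial>lborel) = (\<integral>x. (\<Sum>k\<in>UNIV. d x $ k * (?\<phi> x * n x $ k)) \<partial>lborel)"
      by (simp add: inner sum_distrib_left sum_distrib_right mult_ac)
    also have "\<dots> = ?S"
      unfolding S_def
    proof (intro Bochner_Integration.integral_sum loc_L1_integrable_mult[OF dl, where C=1 and K="box a b"])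
      show "\<bar>?\<phi> x * n x $ k\<bar> \<le> 1" for x k
        using bump_bounds[of m a b x] n1[of x k] by (simp add: abs_mult mult_le_one)
    qed (auto simp: bump_support[OF \<open>m > 0\<close>])
    finally show "(\<integral>x. n x \<bullet> d x * ?\<phi> x \<partial>lborel) = 0"
      using \<open>?S = 0\<close> by simp
  qed
qed

section \<open>The Gagliardo argument in the plane\<close>

text \<open>Lebesgue measure on \<open>real^2\<close> is the image of the product measure under the
  coordinate map, because both give each box the product of its side lengths.\<close>

lemma nn_integral_real2_iterated:
  fixes f :: "real^2 \<Rightarrow> ennreal"
  assumes [measurable]: "f \<in> borel_measurable borel"
  shows "(\<integral>\<^sup>+x. f x \<partial>lborel) = (\<integral>\<^sup>+a. \<integral>\<^sup>+b. f (a *\<^sub>R axis 1 1 + b *\<^sub>R axis 2 1) \<partial>lborel \<partial>lborel)"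
proof -
  let ?p = "\<lambda>(a, b). a *\<^sub>R axis 1 1 + b *\<^sub>R axis 2 1 :: real^2"
  have "lborel = distr (lborel \<Otimes>\<^sub>M lborel) borel ?p"
  proof (rule lborel_eqI)
    fix l u :: "real^2" assume *: "\<And>b. b \<in> Basis \<Longrightarrow> l \<bullet> b \<le> u \<bullet> b"
    have le: "l $ 1 \<le> u $ 1" "l $ 2 \<le> u $ 2"
      using *[of "axis 1 1"] *[of "axis 2 1"] by (simp_all add: inner_axis)
    have "?p -` box l u = {l $ 1<..<u $ 1} \<times> {l $ 2<..<u $ 2}"
      by (auto simp: mem_box_cart forall_2 axis_def)
    then have "emeasure (distr (lborel \<Otimes>\<^sub>M lborel) borel ?p) (box l u) = ennreal (u $ 1 - l $ 1) * ennreal (u $ 2 - l $ 2)"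
      using le by (subst emeasure_distr) (auto simp: borel_open space_pair_measure lborel.emeasure_pair_measure_Times)
    also have "\<dots> = ennreal (\<Prod>b\<in>Basis. (u - l) \<bullet> b)"
    proof -
      have Basis: "(Basis :: (real^2) set) = {axis 1 1, axis 2 1}"
        by (auto simp: Basis_vec_def UNIV_2)
      have "axis 1 1 \<noteq> (axis 2 1 :: real^2)"
        by (simp add: axis_eq_axis)
      then have "(\<Prod>b\<in>Basis. (u - l) \<bullet> b) = (u $ 1 - l $ 1) * (u $ 2 - l $ 2)"
        unfolding Basis by (simp add: inner_axis)
      then show ?thesis
        using le by (simp add: ennreal_mult)
    qed
    finally show "emeasure (distr (lborel \<Otimes>\<^sub>M lborel) borel ?p) (box l u) = ennreal (\<Prod>b\<in>Basis. (u - l) \<bullet> b)" .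
  qed simp
  then have "(\<integral>\<^sup>+x. f x \<partial>lborel) = (\<integral>\<^sup>+x. f x \<partial>distr (lborel \<Otimes>\<^sub>M lborel) borel ?p)"
    by (rule arg_cong)
  also have "\<dots> = (\<integral>\<^sup>+z. f (?p z) \<partial>(lborel \<Otimes>\<^sub>M lborel))"
    by (intro nn_integral_distr) measurable
  also have "\<dots> = (\<integral>\<^sup>+a. \<integral>\<^sup>+b. f (?p (a, b)) \<partial>lborel \<partial>lborel)"
    by (intro lborel.nn_integral_fst[symmetric]) measurable
  finally show ?thesis by simp
qed

text \<open>A full line integral in direction 1 depends on the second coordinate only, and one in
  direction 2 on the first only. The double integral of their product therefore factorizes.\<close>

lemma Gagliardo_real2:
  fixes f g W :: "real^2 \<Rightarrow> ennreal"
  assumes [measurable]: "f \<in> borel_measurable borel" "g \<in> borel_measurable borel"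
    and f: "AE x in lborel. W x \<le> (\<integral>\<^sup>+t. f (x + t *\<^sub>R axis 1 1) \<partial>lborel)"
    and g: "AE x in lborel. W x \<le> (\<integral>\<^sup>+t. g (x + t *\<^sub>R axis 2 1) \<partial>lborel)"
  shows "(\<integral>\<^sup>+x. (W x)\<^sup>2 \<partial>lborel) \<le> (\<integral>\<^sup>+x. f x \<partial>lborel) * (\<integral>\<^sup>+x. g x \<partial>lborel)"
proof -
  let ?p = "\<lambda>a b. a *\<^sub>R axis 1 1 + b *\<^sub>R axis 2 1 :: real^2"
  let ?F = "\<lambda>x. \<integral>\<^sup>+t. f (x + t *\<^sub>R axis 1 1) \<partial>lborel"
  let ?G = "\<lambda>x. \<integral>\<^sup>+t. g (x + t *\<^sub>R axis 2 1) \<partial>lborel"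
  have F: "?F (?p a b) = (\<integral>\<^sup>+s. f (?p s b) \<partial>lborel)" for a b
    using nn_integral_translate[of "\<lambda>s. f (?p s b)" a] by (simp add: algebra_simps)
  have G: "?G (?p a b) = (\<integral>\<^sup>+s. g (?p a s) \<partial>lborel)" for a b
    using nn_integral_translate[of "\<lambda>s. g (?p a s)" b] by (simp add: algebra_simps)
  have "(\<integral>\<^sup>+x. (W x)\<^sup>2 \<partial>lborel) \<le> (\<integral>\<^sup>+x. ?F x * ?G x \<partial>lborel)"
  proof (rule nn_integral_mono_AE)
    show "AE x in lborel. (W x)\<^sup>2 \<le> ?F x * ?G x"
      using f g by eventually_elim (auto simp: power2_eq_square intro: mult_mono)
  qed
  also have "\<dots> = (\<integral>\<^sup>+a. \<integral>\<^sup>+b. (\<integral>\<^sup>+s. f (?p s b) \<partial>lborel) * (\<integral>\<^sup>+s. g (?p a s) \<partial>lborel) \<partial>lborel \<partial>lborel)"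
    by (subst nn_integral_real2_iterated) (simp_all only: F G, measurable)
  also have "\<dots> = (\<integral>\<^sup>+b. \<integral>\<^sup>+s. f (?p s b) \<partial>lborel \<partial>lborel) * (\<integral>\<^sup>+a. \<integral>\<^sup>+s. g (?p a s) \<partial>lborel \<partial>lborel)"
    by (simp add: nn_integral_multc nn_integral_cmult)
  also have "(\<integral>\<^sup>+b. \<integral>\<^sup>+s. f (?p s b) \<partial>lborel \<partial>lborel) = (\<integral>\<^sup>+x. f x \<partial>lborel)"
    unfolding nn_integral_real2_iterated[OF assms(1)] by (intro lborel_pair.Fubini') measurable
  also have "(\<integral>\<^sup>+a. \<integral>\<^sup>+s. g (?p a s) \<partial>lborel \<partial>lborel) = (\<integral>\<^sup>+x. g x \<partial>lborel)"
    by (simp add: nn_integral_real2_iterated[OF assms(2)])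
  finally show ?thesis .
qed

text \<open>Finiteness of the integral of \<open>c - u\<close> replaces decay at infinity: the value
  at \<open>x\<close> is at most the value at \<open>x + N e\<close> plus the line integral of the
  absolute derivative, and the former is negligible for large \<open>N\<close> in an averaged
  sense.\<close>

lemma weak_partial_line_bound:
  assumes w: "weak_partial i u d" and le: "\<And>x. u x \<le> c"
    and fin: "(\<integral>\<^sup>+x. ennreal (c - u x) \<partial>lborel) < \<infinity>"
  shows "AE x in lborel. ennreal (c - u x) \<le> (\<integral>\<^sup>+t. ennreal \<bar>d (x + t *\<^sub>R axis i 1)\<bar> \<partial>lborel)"
proof -
  have [measurable]: "u \<in> borel_measurable borel" "d \<in> borel_measurable borel"
    using w by (auto simp: weak_partial_def loc_L1_def)
  let ?e = "axis i 1 :: real^2"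
  let ?W = "\<lambda>x. ennreal (c - u x)" and ?A = "\<lambda>x. \<integral>\<^sup>+t. ennreal \<bar>d (x + t *\<^sub>R ?e)\<bar> \<partial>lborel"
  have step: "AE x in lborel. ?W x \<le> ?W (x + real N *\<^sub>R ?e) + ?A x" for N
    using weak_partial_translate[OF w, of "real N", simplified]
  proof eventually_elim
    case (elim x)
    let ?I = "\<integral>t. indicator {0..real N} t * d (x + t *\<^sub>R ?e) \<partial>lborel"
    have "ennreal \<bar>?I\<bar> \<le> (\<integral>\<^sup>+t. ennreal \<bar>indicator {0..real N} t * d (x + t *\<^sub>R ?e)\<bar> \<partial>lborel)"
      by (rule ennreal_abs_integral_le)
    also have "\<dots> \<le> ?A x"
      by (intro nn_integral_mono) (simp split: split_indicator)
    finally have I: "ennreal \<bar>?I\<bar> \<le> ?A x" .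
    have "?W x \<le> ennreal ((c - u (x + real N *\<^sub>R ?e)) + \<bar>?I\<bar>)"
      using elim by (intro ennreal_leI) linarith
    also have "\<dots> = ?W (x + real N *\<^sub>R ?e) + ennreal \<bar>?I\<bar>"
      using le by (intro ennreal_plus) (auto simp: le_diff_eq)
    also have "\<dots> \<le> ?W (x + real N *\<^sub>R ?e) + ?A x"
      using I by (intro add_left_mono)
    finally show ?case .
  qed
  \<comment> \<open>Over a fixed ball, the mass of \<open>?W\<close> translated by \<open>N\<close> vanishes as \<open>N\<close> grows.\<close>
  have "AE x in lborel. x \<in> cball 0 R \<longrightarrow> ?W x \<le> ?A x" for R :: real
  proof -
    have [measurable]: "cball 0 R \<in> sets (borel :: (real^2) measure)" by simp
    \<comment> \<open>Subtraction in \<open>ennreal\<close> is truncated and \<open>?W\<close> is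
      finite, so vanishing of \<open>?J\<close> means \<open>?W \<le> ?A\<close> almost everywhere
      on the ball.\<close>
    let ?J = "\<integral>\<^sup>+x. (?W x - ?A x) * indicator (cball 0 R) x \<partial>lborel"
    have J: "?J \<le> (\<integral>\<^sup>+x. ?W x * indicator (cball 0 R) (x - real N *\<^sub>R ?e) \<partial>lborel)" for N
    proof -
      have "?J \<le> (\<integral>\<^sup>+x. ?W (x + real N *\<^sub>R ?e) * indicator (cball 0 R) x \<partial>lborel)"
        using step[of N]
        by (intro nn_integral_mono_AE, eventually_elim)
          (auto intro!: mult_right_mono simp: ennreal_minus_le_iff add.commute)
      also have "\<dots> = (\<integral>\<^sup>+x. ?W x * indicator (cball 0 R) (x - real N *\<^sub>R ?e) \<partial>lborel)"
        using nn_integral_translate[of "\<lambda>x. ?W x * indicator (cball 0 R) (x - real N *\<^sub>R ?e)" "real N *\<^sub>R ?e"]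
        by simp
      finally show ?thesis .
    qed
    have "(\<lambda>N. \<integral>\<^sup>+x. ?W x * indicator (cball 0 R) (x - real N *\<^sub>R ?e) \<partial>lborel) \<longlonglongrightarrow> (\<integral>\<^sup>+x. 0 \<partial>(lborel :: (real^2) measure))"
    proof (rule nn_integral_dominated_convergence[where w="?W"])
      show "AE x in lborel. (\<lambda>N. ?W x * indicator (cball 0 R) (x - real N *\<^sub>R ?e)) \<longlonglongrightarrow> 0"
      proof (rule AE_I2)
        fix x :: "real^2"
        obtain M :: nat where M: "norm x + R < real M" using reals_Archimedean2 by blast
        have "x - real N *\<^sub>R ?e \<notin> cball 0 R" if "N \<ge> M" for N
          using norm_triangle_ineq2[of "real N *\<^sub>R ?e" x] M that by (auto simp: norm_minus_commute)
        then have "\<forall>\<^sub>F N in sequentially. ?W x * indicator (cball 0 R) (x - real N *\<^sub>R ?e) = 0"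
          by (intro eventually_sequentiallyI[of M]) simp
        then show "(\<lambda>N. ?W x * indicator (cball 0 R) (x - real N *\<^sub>R ?e)) \<longlonglongrightarrow> 0"
          by (rule tendsto_eventually)
      qed
    qed (use fin in \<open>auto split: split_indicator\<close>)
    then have "?J \<le> 0"
      by (intro LIMSEQ_le_const[of "\<lambda>N. \<integral>\<^sup>+x. ?W x * indicator (cball 0 R) (x - real N *\<^sub>R ?e) \<partial>lborel"])
        (use J in auto)
    then have "AE x in lborel. (?W x - ?A x) * indicator (cball 0 R) x = 0"
      by (subst (asm) le_zero_eq, subst (asm) nn_integral_0_iff_AE) auto
    then show ?thesis
      by eventually_elim (auto simp: diff_eq_0_iff_ennreal)
  qed
  then have "AE x in lborel. \<forall>R::nat. x \<in> cball 0 (real R) \<longrightarrow> ?W x \<le> ?A x"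
    unfolding AE_all_countable by blast
  then show ?thesis
  proof eventually_elim
    case (elim x)
    then show ?case using real_arch_simple[of "norm x"] by auto
  qed
qed

section \<open>The energy estimate\<close>

lemma e3_nth: "e3 $ 1 = 0" "e3 $ 2 = 0" "e3 $ 3 = 1"
  by (simp_all add: e3_def axis_def)

lemma inner_e3: "x \<bullet> e3 = x $ 3" "e3 \<bullet> x = x $ 3"
  by (simp_all add: e3_def inner_axis inner_axis')

lemma norm_minus_e3_sq:
  assumes "norm x = 1"
  shows "(norm (x - e3))\<^sup>2 = 2 * (1 - x $ 3)"
proof -
  have "x \<bullet> x = 1" using assms by (simp add: norm_eq_1)
  moreover have "e3 \<bullet> e3 = 1" by (simp add: inner_e3 e3_nth)
  ultimately show ?thesis
    by (simp add: power2_norm_eq_inner inner_diff_left inner_diff_right inner_e3)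
qed

section \<open>Integrability and orthogonality in the energy space\<close>

lemma in_M_measurable:
  assumes "in_M n d"
  shows "n \<in> borel_measurable borel" "d i \<in> borel_measurable borel"
proof -
  show "n \<in> borel_measurable borel" using assms by (simp add: in_M_def)
  have "(\<lambda>x. d i x $ k) \<in> borel_measurable borel" for k
    using assms by (simp add: in_M_def weak_grad_L2loc_def loc_L2_def)
  then show "d i \<in> borel_measurable borel"
    unfolding borel_measurable_euclidean_space[of "d i"] by (auto simp: Basis_vec_def inner_axis)
qed

lemma in_M_integrable:
  assumes M: "in_M n d"
  shows "integrable lborel (\<lambda>x. (norm (d i x))\<^sup>2)" "integrable lborel (\<lambda>x. (d i x $ k)\<^sup>2)"
    "integrable lborel (\<lambda>x. norm (n x - e3) ^ 4)"
proof -
  note [measurable] = in_M_measurable[OF M]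
  have int: "integrable lborel (\<lambda>x. (norm (d 1 x))\<^sup>2 + (norm (d 2 x))\<^sup>2)"
    using M by (intro integrableI_nonneg) (auto simp: in_M_def)
  have "\<forall>i. integrable lborel (\<lambda>x. (norm (d i x))\<^sup>2)"
    unfolding forall_2 using int
    by (auto intro: Bochner_Integration.integrable_bound[OF int])
  then show *: "integrable lborel (\<lambda>x. (norm (d i x))\<^sup>2)" ..
  have "(\<lambda>x. d i x $ k) \<in> borel_measurable borel"
    using M by (simp add: in_M_def weak_grad_L2loc_def loc_L2_def)
  then show "integrable lborel (\<lambda>x. (d i x $ k)\<^sup>2)"
    using component_le_norm_cart[of "d i _" k]
    by (intro Bochner_Integration.integrable_bound[OF *]) (auto intro!: AE_I2 simp: abs_le_square_iff[symmetric])
  show "integrable lborel (\<lambda>x. norm (n x - e3) ^ 4)"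
    using M by (intro integrableI_nonneg) (auto simp: in_M_def)
qed

lemma in_M_orthogonal:
  assumes M: "in_M n d"
  shows "AE x in lborel. n x \<bullet> d i x = 0"
  using M in_M_integrable(2)[OF M]
  by (intro sphere_map_orthogonal) (auto simp: in_M_def sphere_map_def weak_grad_L2loc_def)

text \<open>Splitting \<open>n\<close> into \<open>n - e3\<close> and \<open>e3\<close> in the
  orthogonality relation expresses this component through \<open>n - e3\<close>; Cauchy-Schwarz then
  gains the factor \<open>norm (n x - e3)\<close>.\<close>

lemma in_M_third_component:
  assumes M: "in_M n d"
  shows "AE x in lborel. \<bar>d i x $ 3\<bar> \<le> norm (n x - e3) * norm (d i x)"
  using in_M_orthogonal[OF M, of i]
proof eventually_elim
  case (elim x)
  then have "d i x $ 3 = - ((n x - e3) \<bullet> d i x)"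
    by (simp add: inner_diff_left inner_e3)
  then show ?case
    using Cauchy_Schwarz_ineq2[of "n x - e3" "d i x"] by simp
qed

text \<open>The Gagliardo inequality is applied to \<open>1 - n x $ 3\<close>, whose square is a
  quarter of the quartic density. Each \<open>?D i\<close> is bounded by Cauchy-Schwarz, and the
  arithmetic-geometric mean inequality turns the product of the two into half a sum. Hence the
  constant is 4 / 2 = 2.\<close>

lemma in_M_quartic_bound:
  assumes M: "in_M n d" and X: "integrable lborel (\<lambda>x. (norm (n x - e3))\<^sup>2)"
  shows "(\<integral>x. norm (n x - e3) ^ 4 \<partial>lborel)
    \<le> 2 * (\<integral>x. (norm (n x - e3))\<^sup>2 \<partial>lborel)
        * (\<integral>x. (norm (d 1 x))\<^sup>2 + (norm (d 2 x))\<^sup>2 \<partial>lborel)"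
proof -
  note [measurable] = in_M_measurable[OF M]
  have d3 [measurable]: "(\<lambda>x. d i x $ 3) \<in> borel_measurable borel" for i
    using M by (simp add: in_M_def weak_grad_L2loc_def loc_L2_def)
  have sphere: "norm (n x) = 1" for x
    using M by (simp add: in_M_def sphere_map_def)
  have w: "1 - n x $ 3 = (norm (n x - e3))\<^sup>2 / 2" for x
    using norm_minus_e3_sq[OF sphere] by simp
  let ?X = "\<integral>x. (norm (n x - e3))\<^sup>2 \<partial>lborel" and ?Y = "\<lambda>i. \<integral>x. (norm (d i x))\<^sup>2 \<partial>lborel"
  let ?D = "\<lambda>i. \<integral>\<^sup>+x. ennreal \<bar>d i x $ 3\<bar> \<partial>lborel"
  have line: "AE x in lborel. ennreal (1 - n x $ 3) \<le> (\<integral>\<^sup>+t. ennreal \<bar>d i (x + t *\<^sub>R axis i 1) $ 3\<bar> \<partial>lborel)" for i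
  proof (rule weak_partial_line_bound)
    show "weak_partial i (\<lambda>x. n x $ 3) (\<lambda>x. d i x $ 3)"
      using M by (simp add: in_M_def weak_grad_L2loc_def)
    show "n x $ 3 \<le> 1" for x
      using component_le_norm_cart[of "n x" 3] sphere[of x] by simp
    show "(\<integral>\<^sup>+x. ennreal (1 - n x $ 3) \<partial>lborel) < \<infinity>"
      unfolding w using integrable_divide[OF X, of 2] by (simp add: integrable_iff_bounded)
  qed
  have Di: "(?D i)\<^sup>2 \<le> ennreal (?X * ?Y i)" for i
  proof -
    have "?D i \<le> (\<integral>\<^sup>+x. ennreal (norm (n x - e3)) * ennreal (norm (d i x)) \<partial>lborel)"
      using in_M_third_component[OF M, of i]
      by (intro nn_integral_mono_AE) (auto elim!: eventually_mono simp flip: ennreal_mult intro!: ennreal_leI)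
    then have "(?D i)\<^sup>2 \<le> (\<integral>\<^sup>+x. ennreal (norm (n x - e3)) * ennreal (norm (d i x)) \<partial>lborel)\<^sup>2"
      by (rule power_mono) simp
    also have "\<dots> \<le> (\<integral>\<^sup>+x. (ennreal (norm (n x - e3)))\<^sup>2 \<partial>lborel) * (\<integral>\<^sup>+x. (ennreal (norm (d i x)))\<^sup>2 \<partial>lborel)"
      by (intro Cauchy_Schwarz_nn_integral) measurable
    also have "\<dots> = ennreal ?X * ennreal (?Y i)"
      by (simp add: ennreal_power nn_integral_eq_integral[OF X] nn_integral_eq_integral[OF in_M_integrable(1)[OF M]])
    finally show ?thesis by (simp add: ennreal_mult)
  qed
  have Dfin: "?D i < \<infinity>" for i
  proof -
    have "(?D i)\<^sup>2 < top"
      by (rule le_less_trans[OF Di[of i]]) simp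
    then show ?thesis by (simp add: power_less_top_ennreal)
  qed
  then obtain a where a: "\<And>i. ?D i = ennreal (a i)" "\<And>i. a i \<ge> 0"
    using that[of "\<lambda>i. enn2real (?D i)"] by simp
  have a2: "(a i)\<^sup>2 \<le> ?X * ?Y i" for i
    using Di[of i] a by (simp add: ennreal_power)
  have "(\<integral>\<^sup>+x. (ennreal (1 - n x $ 3))\<^sup>2 \<partial>lborel) \<le> ?D 1 * ?D 2"
    using line[of 1] line[of 2] by (intro Gagliardo_real2) auto
  also have "(\<integral>\<^sup>+x. (ennreal (1 - n x $ 3))\<^sup>2 \<partial>lborel) = (\<integral>\<^sup>+x. ennreal (norm (n x - e3) ^ 4 / 4) \<partial>lborel)"
    unfolding w by (simp add: ennreal_power power_divide flip: power_mult)
  also have "\<dots> = ennreal ((\<integral>x. norm (n x - e3) ^ 4 \<partial>lborel) / 4)"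
    using in_M_integrable(3)[OF M] by (subst nn_integral_eq_integral) auto
  finally have "(\<integral>x. norm (n x - e3) ^ 4 \<partial>lborel) / 4 \<le> a 1 * a 2"
    using a by (simp flip: ennreal_mult)
  also have "a 1 * a 2 \<le> ((a 1)\<^sup>2 + (a 2)\<^sup>2) / 2"
    using sum_squares_bound[of "a 1" "a 2"] by simp
  also have "\<dots> \<le> (?X * ?Y 1 + ?X * ?Y 2) / 2"
    using a2[of 1] a2[of 2] by simp
  also have "\<dots> = ?X * (\<integral>x. (norm (d 1 x))\<^sup>2 + (norm (d 2 x))\<^sup>2 \<partial>lborel) / 2"
    using in_M_integrable(1)[OF M] by (simp add: distrib_left)
  finally show ?thesis by simp
qed

lemma helicity_density_bound:
  fixes m c1 c2 :: "real^3"
  assumes c: "\<bar>c1 $ 3\<bar> \<le> norm m * norm c1" "\<bar>c2 $ 3\<bar> \<le> norm m * norm c2"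
    and m3: "m $ 3 = - (norm m)\<^sup>2 / 2" and "s > 0"
  shows "\<bar>m $ 1 * c2 $ 3 - m $ 2 * c1 $ 3 + m $ 3 * (c1 $ 2 - c2 $ 1)\<bar>
    \<le> 3 / 2 * (norm m ^ 4 / (2 * s) + s * ((norm c1)\<^sup>2 + (norm c2)\<^sup>2))"
proof -
  have le: "\<bar>m $ k\<bar> \<le> norm m" "\<bar>c1 $ k\<bar> \<le> norm c1" "\<bar>c2 $ k\<bar> \<le> norm c2" for k
    by (rule component_le_norm_cart)+
  have 1: "\<bar>m $ 1 * c2 $ 3\<bar> \<le> (norm m)\<^sup>2 * norm c2"
    using mult_mono[OF le(1)[of 1] c(2)] by (simp add: abs_mult power2_eq_square mult.assoc)
  have 2: "\<bar>m $ 2 * c1 $ 3\<bar> \<le> (norm m)\<^sup>2 * norm c1"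
    using mult_mono[OF le(1)[of 2] c(1)] by (simp add: abs_mult power2_eq_square mult.assoc)
  have "\<bar>c1 $ 2 - c2 $ 1\<bar> \<le> norm c1 + norm c2"
    using le(2)[of 2] le(3)[of 1] by linarith
  then have 3: "\<bar>m $ 3 * (c1 $ 2 - c2 $ 1)\<bar> \<le> (norm m)\<^sup>2 / 2 * (norm c1 + norm c2)"
    unfolding m3 abs_mult by (intro mult_mono) auto
  \<comment> \<open>The weight \<open>s\<close> is the bound on the distance used later: once the
    quartic integral is at most \<open>2 * s\<^sup>2\<close> times the gradient integral, both terms
    contribute the same amount.\<close>
  have young: "(norm m)\<^sup>2 * y \<le> norm m ^ 4 / (4 * s) + s * y\<^sup>2" for y
  proof -
    have "0 \<le> ((norm m)\<^sup>2 - 2 * s * y)\<^sup>2 / (4 * s)" using \<open>s > 0\<close> by simp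
    also have "\<dots> = norm m ^ 4 / (4 * s) + s * y\<^sup>2 - (norm m)\<^sup>2 * y"
      using \<open>s > 0\<close> by (simp add: power2_diff power_mult_distrib flip: power_mult)
        (simp add: field_simps power2_eq_square)
    finally show ?thesis by simp
  qed
  have "\<bar>m $ 1 * c2 $ 3 - m $ 2 * c1 $ 3 + m $ 3 * (c1 $ 2 - c2 $ 1)\<bar>
      \<le> 3 / 2 * ((norm m)\<^sup>2 * norm c1 + (norm m)\<^sup>2 * norm c2)"
    using 1 2 3 by (simp add: distrib_left abs_le_iff)
  also have "\<dots> \<le> 3 / 2 * ((norm m ^ 4 / (4 * s) + s * (norm c1)\<^sup>2) + (norm m ^ 4 / (4 * s) + s * (norm c2)\<^sup>2))"
    using young by (intro mult_left_mono add_mono) auto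
  also have "\<dots> = 3 / 2 * (norm m ^ 4 / (2 * s) + s * ((norm c1)\<^sup>2 + (norm c2)\<^sup>2))"
    using \<open>s > 0\<close> by (simp add: field_simps)
  finally show ?thesis .
qed

section \<open>Helicity controlled by the Dirichlet energy, and positivity of the potential\<close>

lemma inner_curl:
  "m \<bullet> curl d x = m $ 1 * d 2 x $ 3 - m $ 2 * d 1 x $ 3 + m $ 3 * (d 1 x $ 2 - d 2 x $ 1)"
  by (simp add: inner_vec_def sum_3 curl_def)

lemma helicity_bound:
  assumes M: "in_M n d" and X: "integrable lborel (\<lambda>x. (norm (n x - e3))\<^sup>2)"
    and le: "(\<integral>x. (norm (n x - e3))\<^sup>2 \<partial>lborel) \<le> s\<^sup>2" and "s > 0"
  shows "\<bar>Hel n d\<bar> \<le> 6 * s * Dir d"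
proof -
  let ?P = "\<integral>x. (norm (d 1 x))\<^sup>2 + (norm (d 2 x))\<^sup>2 \<partial>lborel"
  let ?Q = "\<integral>x. norm (n x - e3) ^ 4 \<partial>lborel"
  let ?g = "\<lambda>x. 3 / 2 * (norm (n x - e3) ^ 4 / (2 * s) + s * ((norm (d 1 x))\<^sup>2 + (norm (d 2 x))\<^sup>2))"
  have int: "integrable lborel ?g"
    by (intro integrable_mult_right Bochner_Integration.integrable_add integrable_divide in_M_integrable[OF M])
  have "AE x in lborel. \<bar>(n x - e3) \<bullet> curl d x\<bar> \<le> ?g x"
    using in_M_third_component[OF M, of 1] in_M_third_component[OF M, of 2]
  proof eventually_elim
    case (elim x)
    have "norm (n x) = 1" using M by (simp add: in_M_def sphere_map_def)
    from norm_minus_e3_sq[OF this] show ?case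
      unfolding inner_curl by (intro helicity_density_bound elim \<open>s > 0\<close>) (simp add: e3_nth)
  qed
  then have "(\<integral>x. \<bar>(n x - e3) \<bullet> curl d x\<bar> \<partial>lborel) \<le> (\<integral>x. ?g x \<partial>lborel)"
    by (intro integral_mono_AE' int) auto
  then have "\<bar>Hel n d\<bar> \<le> (\<integral>x. ?g x \<partial>lborel)"
    unfolding Hel_def using integral_abs_bound[of lborel "\<lambda>x. (n x - e3) \<bullet> curl d x"] by linarith
  also have "\<dots> = 3 / 2 * (?Q / (2 * s) + s * ?P)"
    using in_M_integrable[OF M] by simp
  \<comment> \<open>The quartic bound makes each of the two terms at most \<open>s * ?P\<close>; the
    total \<open>3 * s * ?P\<close> equals \<open>6 * s * Dir d\<close> because \<open>Dir\<close>
    carries the factor 1 / 2.\<close>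
  also have "\<dots> \<le> 3 / 2 * (2 * s\<^sup>2 * ?P / (2 * s) + s * ?P)"
  proof -
    have "?Q \<le> 2 * (\<integral>x. (norm (n x - e3))\<^sup>2 \<partial>lborel) * ?P"
      by (rule in_M_quartic_bound[OF M X])
    also have "\<dots> \<le> 2 * s\<^sup>2 * ?P"
      using le by (intro mult_right_mono mult_left_mono) auto
    finally show ?thesis using \<open>s > 0\<close> by (intro mult_left_mono add_right_mono divide_right_mono) auto
  qed
  also have "\<dots> = 6 * s * Dir d"
    using \<open>s > 0\<close> by (simp add: Dir_def power2_eq_square)
  finally show ?thesis .
qed

text \<open>A vanishing quartic integral would force \<open>n = e3\<close> almost everywhere and
  hence zero distance. Membership in the energy space supplies the integrability that rules out the
  default value 0.\<close>

lemma Pot_pos: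
  assumes M: "in_M n d" and "0 < L2dist_sq n"
  shows "0 < Pot n"
proof -
  note [measurable] = in_M_measurable[OF M]
  have "\<not> (AE x in lborel. norm (n x - e3) ^ 4 = 0)"
  proof
    assume "AE x in lborel. norm (n x - e3) ^ 4 = 0"
    then have "L2dist_sq n = 0"
      unfolding L2dist_sq_def by (subst nn_integral_0_iff_AE) auto
    then show False using assms(2) by simp
  qed
  then have "(\<integral>x. norm (n x - e3) ^ 4 \<partial>lborel) \<noteq> 0"
    using integral_nonneg_eq_0_iff_AE[OF in_M_integrable(3)[OF M]] by simp
  moreover have "0 \<le> (\<integral>x. norm (n x - e3) ^ 4 \<partial>lborel)" by simp
  ultimately have "0 < (\<integral>x. norm (n x - e3) ^ 4 \<partial>lborel)" by linarith
  then show ?thesis by (simp add: Pot_def)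
qed

theorem theorem1p3:
  fixes r :: real
  assumes "r > 0"
  shows "\<exists>\<delta>>0. \<forall>n d. in_M n d \<and> 0 < L2dist_sq n \<and> L2dist_sq n \<le> ennreal (\<delta>\<^sup>2)
           \<longrightarrow> energy r n d > energy r (\<lambda>_. e3) (\<lambda>_ _. 0)"
proof (intro exI[of _ "1 / (6 * r)"] conjI allI impI)
  show "1 / (6 * r) > 0" using assms by simp
  fix n d
  assume *: "in_M n d \<and> 0 < L2dist_sq n \<and> L2dist_sq n \<le> ennreal ((1 / (6 * r))\<^sup>2)"
  then have M: "in_M n d" by simp
  note [measurable] = in_M_measurable[OF M]
  have X: "integrable lborel (\<lambda>x. (norm (n x - e3))\<^sup>2)"
    using * by (intro integrableI_nonneg) (auto simp: L2dist_sq_def intro: le_less_trans)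
  then have "(\<integral>x. (norm (n x - e3))\<^sup>2 \<partial>lborel) \<le> (1 / (6 * r))\<^sup>2"
    using * by (simp add: L2dist_sq_def nn_integral_eq_integral)
  from helicity_bound[OF M X this] have "\<bar>Hel n d\<bar> \<le> 6 * (1 / (6 * r)) * Dir d"
    using assms by simp
  \<comment> \<open>The radius \<open>1 / (6 * r)\<close> is the one for which \<open>r\<close>
    times the helicity constant equals 1.\<close>
  then have "r * \<bar>Hel n d\<bar> \<le> Dir d"
    using assms by (simp add: field_simps)
  moreover have "- (r * \<bar>Hel n d\<bar>) \<le> r * Hel n d"
    using mult_left_mono[of "- \<bar>Hel n d\<bar>" "Hel n d" r] assms by simp
  moreover have "0 < Pot n" using Pot_pos[OF M] * by simp
  moreover have "energy r (\<lambda>_. e3) (\<lambda>_ _. 0) = 0"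
    by (simp add: energy_def Dir_def Hel_def Pot_def)
  ultimately show "energy r n d > energy r (\<lambda>_. e3) (\<lambda>_ _. 0)"
    by (simp add: energy_def)
qed

end
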